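(* Let $\Phi$ be a finite irreducible crystallographic root system with simple system $\Pi$, and let $\alpha\in\Pi$. Then $$\min\{r\ge0:\overline{\Phi_{\alpha,1}}\subseteq r\cdot\mathcal P_{\Phi_\alpha}\}=\min\{r\ge0:\overline\alpha\in r\cdot\mathcal P_{\Phi_\alpha}\}=\sum_{\varepsilon\in N[\alpha]}-(\alpha,\varepsilon^\vee)\,c_\varepsilon,$$ where $$c_\varepsilon=\max\{(\overline\omega_\varepsilon,o_\eta):\eta\text{ is a }\widehat\Pi^\varepsilon\text{-extremal root in }\Pi^\varepsilon\}.$$
   Context: $\Phi$ is reduced, in a Euclidean space $\mathbb E=\mathrm{Span}_{\mathbb R}\Phi$ with Weyl-group-invariant form $(\cdot,\cdot)$, used to identify $\mathbb E$ with its dual; $\varepsilon^\vee=2\varepsilon/(\varepsilon,\varepsilon)$. $\{\omega_\varepsilon\}_{\varepsilon\in\Pi}$ (fundamental weights) is the basis dual to the simple coroots $\{\varepsilon^\vee\}_{\varepsilon\in\Pi}$; $\{\check\omega_\varepsilon\}_{\varepsilon\in\Pi}$ (fundamental co-weights) is the basis dual to $\Pi$. $\Phi_{\alpha,1}$ is the set of roots whose $\alpha$-coordinate with respect to $\Pi$ equals $1$; $\Phi_\alpha$ is the root subsystem generated by $\Pi\setminus\{\alpha\}$; $\mathcal P_{\Phi_\alpha}$ is the convex hull of $\Phi_\alpha$ (taken to be $\{0\}$ if $\Phi_\alpha=\emptyset$). An overline denotes the orthogonal projection onto $\mathrm{Span}(\Pi\setminus\{\alpha\})$. $N[\alpha]=\{\varepsilon\in\Pi\setminus\{\alpha\}:(\varepsilon,\alpha)\ne0\}$.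 For $\varepsilon\in N[\alpha]$, $\Phi^\varepsilon$ is the irreducible component of $\Phi_\alpha$ containing $\varepsilon$, $\Pi^\varepsilon=\Pi\cap\Phi^\varepsilon$, $\theta^\varepsilon=\sum_{\eta\in\Pi^\varepsilon}m_\eta\eta$ is the highest root of $\Phi^\varepsilon$, and $o_\eta=\check\omega_\eta/m_\eta$ for $\eta\in\Pi^\varepsilon$. A root $\eta\in\Pi^\varepsilon$ is $\widehat\Pi^\varepsilon$-extremal if removing the vertex $\eta$ from the extended Dynkin diagram of $\Phi^\varepsilon$ (vertices: $\Pi^\varepsilon$ and the affine vertex) leaves a connected graph. *)

theory Defs
  imports "HOL-Analysis.Analysis"
begin

definition coroot :: "'a::euclidean_space \<Rightarrow> 'a" where
  "coroot \<beta> = (2 / (\<beta> \<bullet> \<beta>)) *\<^sub>R \<beta>"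

definition root_reflection :: "'a::euclidean_space \<Rightarrow> 'a \<Rightarrow> 'a" where
  "root_reflection \<beta> x = x - (x \<bullet> coroot \<beta>) *\<^sub>R \<beta>"

text \<open>Finite reduced crystallographic root systems. The ambient type is the span of the roots, and its
  inner product is invariant under the Weyl group because the reflections are orthogonal.\<close>

definition root_system :: "'a::euclidean_space set \<Rightarrow> bool" where
  "root_system \<Phi> \<longleftrightarrow>
     finite \<Phi> \<and> span \<Phi> = UNIV \<and> 0 \<notin> \<Phi> \<and>
     (\<forall>\<beta>\<in>\<Phi>. root_reflection \<beta> ` \<Phi> = \<Phi>) \<and>
     (\<forall>\<beta>\<in>\<Phi>. \<forall>\<gamma>\<in>\<Phi>. \<beta> \<bullet> coroot \<gamma> \<in> \<int>) \<and>
     (\<forall>\<beta>\<in>\<Phi>. \<forall>c. c *\<^sub>R \<beta> \<in> \<Phi> \<longrightarrow> c = 1 \<or> c = -1)"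

definition irreducible_roots :: "'a::euclidean_space set \<Rightarrow> bool" where
  "irreducible_roots \<Psi> \<longleftrightarrow>
     \<Psi> \<noteq> {} \<and>
     \<not> (\<exists>A B. A \<noteq> {} \<and> B \<noteq> {} \<and> A \<union> B = \<Psi> \<and> A \<inter> B = {} \<and> (\<forall>a\<in>A. \<forall>b\<in>B. a \<bullet> b = 0))"

text \<open>For \<open>\<beta>\<close> in the span of a basis \<open>\<Delta>\<close>, \<open>representation \<Delta> \<beta> \<eta>\<close> is the \<open>\<eta>\<close>-coordinate of \<open>\<beta>\<close>.\<close>

definition simple_system :: "'a::euclidean_space set \<Rightarrow> 'a set \<Rightarrow> bool" where
  "simple_system \<Phi> \<Delta> \<longleftrightarrow>
     \<Delta> \<subseteq> \<Phi> \<and> independent \<Delta> \<and> span \<Delta> = span \<Phi> \<and>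
     (\<forall>\<beta>\<in>\<Phi>. (\<forall>\<eta>\<in>\<Delta>. representation \<Delta> \<beta> \<eta> \<in> \<int>) \<and>
            ((\<forall>\<eta>\<in>\<Delta>. representation \<Delta> \<beta> \<eta> \<ge> 0) \<or> (\<forall>\<eta>\<in>\<Delta>. representation \<Delta> \<beta> \<eta> \<le> 0)))"

definition root_subsystem :: "'a::euclidean_space set \<Rightarrow> 'a set \<Rightarrow> bool" where
  "root_subsystem \<Phi> \<Psi> \<longleftrightarrow> \<Psi> \<subseteq> \<Phi> \<and> (\<forall>\<beta>\<in>\<Psi>. root_reflection \<beta> ` \<Psi> = \<Psi>)"

definition irreducible_component :: "'a::euclidean_space set \<Rightarrow> 'a set \<Rightarrow> bool" where
  "irreducible_component \<Psi> C \<longleftrightarrow>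
     C \<subseteq> \<Psi> \<and> irreducible_roots C \<and> (\<forall>x\<in>C. \<forall>y\<in>\<Psi> - C. x \<bullet> y = 0)"

definition highest_root :: "'a::euclidean_space set \<Rightarrow> 'a set \<Rightarrow> 'a" where
  "highest_root \<Psi> \<Delta> =
     (THE \<theta>. \<theta> \<in> \<Psi> \<and> (\<forall>\<beta>\<in>\<Psi>. \<forall>\<eta>\<in>\<Delta>. representation \<Delta> \<beta> \<eta> \<le> representation \<Delta> \<theta> \<eta>))"

definition fundamental_weight :: "'a::euclidean_space set \<Rightarrow> 'a \<Rightarrow> 'a" where
  "fundamental_weight \<Delta> \<epsilon> = (THE w. \<forall>\<eta>\<in>\<Delta>. w \<bullet> coroot \<eta> = (if \<eta> = \<epsilon> then 1 else 0))"

definition fundamental_coweight :: "'a::euclidean_space set \<Rightarrow> 'a \<Rightarrow> 'a" where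
  "fundamental_coweight \<Delta> \<epsilon> = (THE w. \<forall>\<eta>\<in>\<Delta>. w \<bullet> \<eta> = (if \<eta> = \<epsilon> then 1 else 0))"

text \<open>The convention for the empty set makes the root polytope of the empty root system a point.\<close>

definition root_polytope :: "'a::euclidean_space set \<Rightarrow> 'a set" where
  "root_polytope \<Psi> = (if \<Psi> = {} then {0} else convex hull \<Psi>)"

text \<open>Bond multiplicities and orientations are irrelevant for connectivity, so the diagram on a set of
  vertices is recorded by its pairs of distinct non-orthogonal vertices.\<close>

definition dynkin_edges :: "'a::euclidean_space set \<Rightarrow> ('a \<times> 'a) set" where
  "dynkin_edges V = {(x, y). x \<in> V \<and> y \<in> V \<and> x \<noteq> y \<and> x \<bullet> y \<noteq> 0}"

definition dynkin_connected :: "'a::euclidean_space set \<Rightarrow> bool" where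
  "dynkin_connected V \<longleftrightarrow> V \<noteq> {} \<and> (\<forall>x\<in>V. \<forall>y\<in>V. (x, y) \<in> (dynkin_edges V)\<^sup>*)"

text \<open>The affine vertex of the extended diagram is represented by the lowest root.\<close>

definition extended_dynkin_vertices :: "'a::euclidean_space set \<Rightarrow> 'a set \<Rightarrow> 'a set" where
  "extended_dynkin_vertices \<Psi> \<Delta> = insert (- highest_root \<Psi> \<Delta>) \<Delta>"

definition extremal_root :: "'a::euclidean_space set \<Rightarrow> 'a set \<Rightarrow> 'a \<Rightarrow> bool" where
  "extremal_root \<Psi> \<Delta> \<eta> \<longleftrightarrow>
     \<eta> \<in> \<Delta> \<and> dynkin_connected (extended_dynkin_vertices \<Psi> \<Delta> - {\<eta>})"

definition orthogonal_projection :: "'a::euclidean_space set \<Rightarrow> 'a \<Rightarrow> 'a" where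
  "orthogonal_projection U x = (THE y. y \<in> U \<and> (\<forall>u\<in>U. orthogonal (x - y) u))"

definition coordinate_one_roots :: "'a::euclidean_space set \<Rightarrow> 'a set \<Rightarrow> 'a \<Rightarrow> 'a set" where
  "coordinate_one_roots \<Phi> \<Delta> \<alpha> = {\<beta> \<in> \<Phi>. representation \<Delta> \<beta> \<alpha> = 1}"

definition parabolic_subsystem :: "'a::euclidean_space set \<Rightarrow> 'a set \<Rightarrow> 'a \<Rightarrow> 'a set" where
  "parabolic_subsystem \<Phi> \<Delta> \<alpha> = (root_subsystem \<Phi>) hull (\<Delta> - {\<alpha>})"

definition parabolic_projection :: "'a::euclidean_space set \<Rightarrow> 'a \<Rightarrow> 'a \<Rightarrow> 'a" where
  "parabolic_projection \<Delta> \<alpha> = orthogonal_projection (span (\<Delta> - {\<alpha>}))"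

definition neighbours :: "'a::euclidean_space set \<Rightarrow> 'a \<Rightarrow> 'a set" where
  "neighbours \<Delta> \<alpha> = {\<epsilon> \<in> \<Delta> - {\<alpha>}. \<epsilon> \<bullet> \<alpha> \<noteq> 0}"

definition component_roots :: "'a::euclidean_space set \<Rightarrow> 'a set \<Rightarrow> 'a \<Rightarrow> 'a \<Rightarrow> 'a set" where
  "component_roots \<Phi> \<Delta> \<alpha> \<epsilon> =
     (THE C. irreducible_component (parabolic_subsystem \<Phi> \<Delta> \<alpha>) C \<and> \<epsilon> \<in> C)"

definition component_simple_roots :: "'a::euclidean_space set \<Rightarrow> 'a set \<Rightarrow> 'a \<Rightarrow> 'a \<Rightarrow> 'a set" where
  "component_simple_roots \<Phi> \<Delta> \<alpha> \<epsilon> = \<Delta> \<inter> component_roots \<Phi> \<Delta> \<alpha> \<epsilon>"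

definition mark :: "'a::euclidean_space set \<Rightarrow> 'a set \<Rightarrow> 'a \<Rightarrow> 'a \<Rightarrow> 'a \<Rightarrow> real" where
  "mark \<Phi> \<Delta> \<alpha> \<epsilon> \<eta> =
     (let \<Psi> = component_roots \<Phi> \<Delta> \<alpha> \<epsilon>; \<Delta>' = component_simple_roots \<Phi> \<Delta> \<alpha> \<epsilon>
      in representation \<Delta>' (highest_root \<Psi> \<Delta>') \<eta>)"

text \<open>The coweight is the one of the whole simple system \<open>\<Delta>\<close>, not of the component.\<close>

definition scaled_coweight :: "'a::euclidean_space set \<Rightarrow> 'a set \<Rightarrow> 'a \<Rightarrow> 'a \<Rightarrow> 'a \<Rightarrow> 'a" where
  "scaled_coweight \<Phi> \<Delta> \<alpha> \<epsilon> \<eta> = fundamental_coweight \<Delta> \<eta> /\<^sub>R mark \<Phi> \<Delta> \<alpha> \<epsilon> \<eta>"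

definition extremal_simple_roots :: "'a::euclidean_space set \<Rightarrow> 'a set \<Rightarrow> 'a \<Rightarrow> 'a \<Rightarrow> 'a set" where
  "extremal_simple_roots \<Phi> \<Delta> \<alpha> \<epsilon> =
     {\<eta>. extremal_root (component_roots \<Phi> \<Delta> \<alpha> \<epsilon>) (component_simple_roots \<Phi> \<Delta> \<alpha> \<epsilon>) \<eta>}"

definition component_constant :: "'a::euclidean_space set \<Rightarrow> 'a set \<Rightarrow> 'a \<Rightarrow> 'a \<Rightarrow> real" where
  "component_constant \<Phi> \<Delta> \<alpha> \<epsilon> =
     Max ((\<lambda>\<eta>. parabolic_projection \<Delta> \<alpha> (fundamental_weight \<Delta> \<epsilon>) \<bullet> scaled_coweight \<Phi> \<Delta> \<alpha> \<epsilon> \<eta>)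
          ` extremal_simple_roots \<Phi> \<Delta> \<alpha> \<epsilon>)"

text \<open>The minimum of a possibly infinite set of reals; being a minimum includes being attained.\<close>

definition is_minimum :: "real set \<Rightarrow> real \<Rightarrow> bool" where
  "is_minimum S m \<longleftrightarrow> m \<in> S \<and> (\<forall>r\<in>S. m \<le> r)"

end

theory Submission
  imports Defs
begin

text \<open>Every functional can be reflected by simple roots other than \<open>\<alpha>\<close> until it is dominant on
  \<open>\<Phi>\<^sub>\<alpha>\<close>; such a functional is minimal on the roots of \<open>\<alpha>\<close>-coordinate \<open>1\<close> at \<open>\<alpha>\<close> itself, so by separation
  from the polytope only \<open>\<alpha>\<close> matters. The projection of \<open>-\<alpha>\<close> is the sum over the neighbours \<open>\<epsilon>\<close> of
  \<open>-(\<alpha>, \<epsilon>\<^sup>\<or>)\<close> times the projected fundamental weight. For dominant functionals the highest root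
  of the component of \<open>\<epsilon>\<close> bounds the value on this weight by the maximum of its pairings with all
  \<open>o\<^sub>\<eta>\<close>, and sliding \<open>\<eta>\<close> away from the affine vertex shows that the maximum is attained at an
  extremal \<open>\<eta>\<close>. Conversely, distinct neighbours lie in distinct components because the diagram is a
  forest, so the sum of the maximising \<open>o\<^sub>\<eta>\<close> is at most \<open>1\<close> on \<open>\<Phi>\<^sub>\<alpha>\<close> and attains the claimed value.\<close>

text \<open>The two estimates are dual and meet in the same ratios. If \<open>x\<close> has
  nonnegative coordinates and lies in the span of one component with highest root
  \<open>\<theta>\<close>, the least \<open>c\<close> for which
  \<open>c *\<^sub>R \<theta> - x\<close> has nonnegative coordinates is the maximum of
  \<open>(x \<bullet> cw \<eta>) / m\<close> over all simple roots \<open>\<eta>\<close> of the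
  component, where \<open>m\<close> is the mark of \<open>\<eta>\<close>. Conversely no root has a
  larger \<open>\<eta>\<close>-coordinate than \<open>\<theta>\<close>, so
  \<open>cw \<eta> / m\<close> is a functional bounded by 1 on the roots. The first estimate needs
  every \<open>\<eta>\<close>, while the constant is a maximum over extremal ones; this is why
  extremal and other vertices have to be compared. The comparison is made for dominant
  \<open>x\<close>, which is enough because projected weights are dominant. The affine vertex enters
  only through its inner products with the simple roots, so neither a classification nor a list of
  facets is used. Weights are positive multiples of coweights; the factors cancel against the
  coroots, and the calculations run in terms of \<open>cw\<close>.\<close>

section \<open>Dual vectors, projections and reflections\<close>

lemma inner_eq_on_spanning_set:
  fixes B :: "'a::euclidean_space set"
  assumes "x \<in> span B" "y \<in> span B" "\<And>b. b \<in> B \<Longrightarrow> x \<bullet> b = y \<bullet> b"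
  shows "x = y"
proof -
  have "orthogonal (x - y) b" if "b \<in> B" for b
    using assms(3)[OF that] by (simp add: orthogonal_def inner_diff_left)
  then have "orthogonal (x - y) (x - y)"
    using assms(1,2) by (auto intro: orthogonal_to_span[of _ B] span_diff)
  then show ?thesis by (simp add: orthogonal_def)
qed

text \<open>The prescribed values extend to a linear functional with Riesz vector
  \<open>adjoint f 1\<close>; projecting it to the span does not change its products with
  \<open>B\<close>. Membership in \<open>span B\<close> later confines dual vectors to one
  component.\<close>

lemma span_vector_with_inner_products:
  fixes B :: "'a::euclidean_space set" and g :: "'a \<Rightarrow> real"
  assumes "independent B"
  obtains w where "w \<in> span B" "\<And>b. b \<in> B \<Longrightarrow> w \<bullet> b = g b"
proof -
  obtain f where f: "linear f" "\<And>b. b \<in> B \<Longrightarrow> f b = g b"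
    using linear_independent_extend[OF assms, of g] by blast
  define v where "v = adjoint f 1"
  have v: "v \<bullet> x = f x" for x
    using adjoint_works[OF f(1), of x 1] by (simp add: v_def inner_commute)
  obtain y z where yz: "y \<in> span B" "\<And>w. w \<in> span B \<Longrightarrow> orthogonal z w" "v = y + z"
    using orthogonal_subspace_decomp_exists[of B v] by metis
  have "y \<bullet> b = g b" if "b \<in> B" for b
  proof -
    have "v \<bullet> b = y \<bullet> b"
      using yz(2)[of b] yz(3) that by (simp add: inner_add_left orthogonal_def span_base)
    then show ?thesis using v f(2) that by simp
  qed
  with yz(1) show ?thesis using that by blast
qed

lemma orthogonal_projection_span:
  fixes B :: "'a::euclidean_space set"
  shows "orthogonal_projection (span B) x \<in> span B"
    and "u \<in> span B \<Longrightarrow> orthogonal_projection (span B) x \<bullet> u = x \<bullet> u"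
proof -
  let ?P = "\<lambda>y. y \<in> span B \<and> (\<forall>u\<in>span B. orthogonal (x - y) u)"
  obtain y z where yz: "y \<in> span B" "\<And>w. w \<in> span B \<Longrightarrow> orthogonal z w" "x = y + z"
    using orthogonal_subspace_decomp_exists[of B x] by metis
  have "\<exists>!y. ?P y"
  proof (rule ex1I[of _ y])
    show "?P y" using yz by auto
    fix y' assume "?P y'"
    with \<open>?P y\<close> show "y' = y"
      by (intro inner_eq_on_spanning_set[of _ B])
        (auto simp: orthogonal_def inner_diff_left span_base)
  qed
  then have "?P (orthogonal_projection (span B) x)"
    unfolding orthogonal_projection_def by (rule theI')
  then show "orthogonal_projection (span B) x \<in> span B"
    and "u \<in> span B \<Longrightarrow> orthogonal_projection (span B) x \<bullet> u = x \<bullet> u"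
    by (auto simp: orthogonal_def inner_diff_left)
qed

lemma inner_root_reflection:
  "root_reflection \<beta> x \<bullet> y = x \<bullet> y - (x \<bullet> coroot \<beta>) * (\<beta> \<bullet> y)"
  by (simp add: root_reflection_def inner_diff_left)

lemma root_reflection_inner_commute: "root_reflection \<beta> x \<bullet> y = x \<bullet> root_reflection \<beta> y"
  by (simp add: root_reflection_def coroot_def inner_diff_left inner_diff_right inner_commute)

lemma root_reflection_involution: "root_reflection \<beta> (root_reflection \<beta> x) = x"
  by (cases "\<beta> = 0")
    (simp_all add: root_reflection_def coroot_def inner_diff_left algebra_simps)

lemma root_reflection_self: "root_reflection \<beta> \<beta> = - \<beta>"
proof (cases "\<beta> = 0")
  case False
  then have "\<beta> \<bullet> coroot \<beta> = 2" by (simp add: coroot_def)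
  then show ?thesis by (simp add: root_reflection_def scaleR_2)
qed (simp add: root_reflection_def)

text \<open>The form in which irreducibility is applied, to sets of roots and of simple roots alike:
  an argument that enlarges a subset until it is everything needs only such an exit link.\<close>

lemma irreducible_roots_linkD:
  assumes "irreducible_roots J" "A \<subseteq> J" "A \<noteq> {}" "A \<noteq> J"
  obtains a b where "a \<in> A" "b \<in> J - A" "a \<bullet> b \<noteq> 0"
proof -
  have "\<not> (\<forall>a\<in>A. \<forall>b\<in>J - A. a \<bullet> b = 0)"
  proof
    assume "\<forall>a\<in>A. \<forall>b\<in>J - A. a \<bullet> b = 0"
    with assms(2-4) have "\<exists>A B. A \<noteq> {} \<and> B \<noteq> {} \<and> A \<union> B = J \<and> A \<inter> B = {} \<and> (\<forall>a\<in>A. \<forall>b\<in>B. a \<bullet> b = 0)"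
      by (intro exI[of _ A] exI[of _ "J - A"]) auto
    with conjunct2[OF assms(1)[unfolded irreducible_roots_def]] show False by (rule notE)
  qed
  with that show ?thesis by blast
qed

section \<open>Coordinates with respect to a simple system\<close>

locale simple_roots =
  fixes \<Phi> \<Delta> :: "'a::euclidean_space set"
  assumes root_system: "root_system \<Phi>" and simple_system: "simple_system \<Phi> \<Delta>"
begin

abbreviation cw :: "'a \<Rightarrow> 'a" where "cw \<equiv> fundamental_coweight \<Delta>"

lemma finite_roots: "finite \<Phi>" and zero_not_root: "0 \<notin> \<Phi>"
  and reflection_image: "\<beta> \<in> \<Phi> \<Longrightarrow> root_reflection \<beta> ` \<Phi> = \<Phi>"
  and cartan_int: "\<beta> \<in> \<Phi> \<Longrightarrow> \<gamma> \<in> \<Phi> \<Longrightarrow> \<beta> \<bullet> coroot \<gamma> \<in> \<int>"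
  and reduced: "\<beta> \<in> \<Phi> \<Longrightarrow> c *\<^sub>R \<beta> \<in> \<Phi> \<Longrightarrow> c = 1 \<or> c = -1"
  using root_system by (auto simp: root_system_def)

lemma simple_subset: "\<Delta> \<subseteq> \<Phi>" and independent_simple: "independent \<Delta>"
  and span_simple: "span \<Delta> = UNIV"
  using simple_system root_system by (auto simp: root_system_def simple_system_def)

lemma simple_root: "\<eta> \<in> \<Delta> \<Longrightarrow> \<eta> \<in> \<Phi>"
  using simple_subset by blast

lemma finite_simple: "finite \<Delta>"
  using finite_subset[OF simple_subset finite_roots] .

lemma root_inner_pos: "\<beta> \<in> \<Phi> \<Longrightarrow> \<beta> \<bullet> \<beta> > 0"
  using zero_not_root by auto

lemma reflection_root: "\<beta> \<in> \<Phi> \<Longrightarrow> \<gamma> \<in> \<Phi> \<Longrightarrow> root_reflection \<beta> \<gamma> \<in> \<Phi>"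
  using reflection_image by blast

lemma minus_root: "\<beta> \<in> \<Phi> \<Longrightarrow> - \<beta> \<in> \<Phi>"
  using reflection_root[of \<beta> \<beta>] by (simp add: root_reflection_self)

lemma inner_cw:
  assumes "\<eta> \<in> \<Delta>"
  shows "cw \<epsilon> \<bullet> \<eta> = (if \<eta> = \<epsilon> then 1 else 0)" "\<eta> \<bullet> cw \<epsilon> = (if \<eta> = \<epsilon> then 1 else 0)"
proof -
  let ?P = "\<lambda>w. \<forall>\<eta>\<in>\<Delta>. w \<bullet> \<eta> = (if \<eta> = \<epsilon> then 1 else 0)"
  obtain w where "w \<in> span \<Delta>" and w: "\<And>\<eta>. \<eta> \<in> \<Delta> \<Longrightarrow> w \<bullet> \<eta> = (if \<eta> = \<epsilon> then 1 else 0)"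
    by (rule span_vector_with_inner_products[OF independent_simple, of "\<lambda>\<eta>. if \<eta> = \<epsilon> then 1 else 0"]) auto
  then have "?P w" by blast
  then have "\<exists>!w. ?P w"
    by (intro ex1I[of _ w] inner_eq_on_spanning_set[of _ \<Delta>]) (auto simp: span_simple)
  then have "?P (cw \<epsilon>)"
    unfolding fundamental_coweight_def by (rule theI')
  then show "cw \<epsilon> \<bullet> \<eta> = (if \<eta> = \<epsilon> then 1 else 0)" "\<eta> \<bullet> cw \<epsilon> = (if \<eta> = \<epsilon> then 1 else 0)"
    using assms by (auto simp: inner_commute)
qed

lemma inner_sum_cw:
  assumes "J \<subseteq> \<Delta>" "\<eta> \<in> \<Delta>"
  shows "(\<Sum>\<kappa>\<in>J. c \<kappa> *\<^sub>R \<kappa>) \<bullet> cw \<eta> = (if \<eta> \<in> J then c \<eta> else 0)"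
proof -
  have "(\<Sum>\<kappa>\<in>J. c \<kappa> *\<^sub>R \<kappa>) \<bullet> cw \<eta> = (\<Sum>\<kappa>\<in>J. if \<kappa> = \<eta> then c \<kappa> else 0)"
    using assms by (auto simp: inner_sum_left inner_cw intro!: sum.cong)
  then show ?thesis
    using finite_subset[OF assms(1) finite_simple] by simp
qed

text \<open>Coordinates become inner products, hence linear without side conditions, and the same
  \<open>cw\<close> serves every subset of \<open>\<Delta>\<close>.\<close>

lemma representation_eq_inner_cw:
  assumes "\<eta> \<in> \<Delta>" shows "representation \<Delta> x \<eta> = x \<bullet> cw \<eta>"
proof -
  have "(\<Sum>b\<in>\<Delta>. representation \<Delta> x b *\<^sub>R b) = x"
    using sum_representation_eq[OF independent_simple _ finite_simple, of x] span_simple by simp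
  then show ?thesis using inner_sum_cw[of \<Delta> \<eta> "representation \<Delta> x"] assms by simp
qed

lemma representation_subset_eq_inner_cw:
  assumes "J \<subseteq> \<Delta>" "x \<in> span J" "\<eta> \<in> J" shows "representation J x \<eta> = x \<bullet> cw \<eta>"
  using representation_extend[OF independent_simple assms(2,1)] representation_eq_inner_cw[of \<eta> x]
    assms by auto

lemma simple_expansion: "(\<Sum>\<eta>\<in>\<Delta>. (x \<bullet> cw \<eta>) *\<^sub>R \<eta>) = x"
  using sum_representation_eq[OF independent_simple _ finite_simple, of x] span_simple
  by (simp add: representation_eq_inner_cw)

lemma mem_span_subset_iff:
  assumes "J \<subseteq> \<Delta>" shows "x \<in> span J \<longleftrightarrow> (\<forall>\<eta>\<in>\<Delta> - J. x \<bullet> cw \<eta> = 0)"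
proof
  assume x: "x \<in> span J"
  show "\<forall>\<eta>\<in>\<Delta> - J. x \<bullet> cw \<eta> = 0"
  proof
    fix \<eta> assume \<eta>: "\<eta> \<in> \<Delta> - J"
    have "orthogonal (cw \<eta>) b" if "b \<in> J" for b
      using that \<eta> assms by (auto simp: orthogonal_def inner_cw)
    from orthogonal_to_span[OF x this] show "x \<bullet> cw \<eta> = 0"
      by (simp add: orthogonal_def inner_commute)
  qed
next
  assume "\<forall>\<eta>\<in>\<Delta> - J. x \<bullet> cw \<eta> = 0"
  then have "(\<Sum>\<eta>\<in>J. (x \<bullet> cw \<eta>) *\<^sub>R \<eta>) = (\<Sum>\<eta>\<in>\<Delta>. (x \<bullet> cw \<eta>) *\<^sub>R \<eta>)"
    using assms finite_simple by (intro sum.mono_neutral_left) auto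
  then have "(\<Sum>\<eta>\<in>J. (x \<bullet> cw \<eta>) *\<^sub>R \<eta>) = x" using simple_expansion[of x] by simp
  moreover have "(\<Sum>\<eta>\<in>J. (x \<bullet> cw \<eta>) *\<^sub>R \<eta>) \<in> span J"
    by (intro span_sum span_scale span_base)
  ultimately show "x \<in> span J" by simp
qed

lemma subset_expansion:
  assumes "J \<subseteq> \<Delta>" "x \<in> span J" shows "(\<Sum>\<eta>\<in>J. (x \<bullet> cw \<eta>) *\<^sub>R \<eta>) = x"
proof -
  have "(\<Sum>\<eta>\<in>J. (x \<bullet> cw \<eta>) *\<^sub>R \<eta>) = (\<Sum>\<eta>\<in>\<Delta>. (x \<bullet> cw \<eta>) *\<^sub>R \<eta>)"
    using assms finite_simple mem_span_subset_iff[OF assms(1), of x]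
    by (intro sum.mono_neutral_left) auto
  then show ?thesis using simple_expansion[of x] by simp
qed

lemma eqI_cw:
  assumes "\<And>\<eta>. \<eta> \<in> \<Delta> \<Longrightarrow> x \<bullet> cw \<eta> = y \<bullet> cw \<eta>" shows "x = y"
proof -
  have "(\<Sum>\<eta>\<in>\<Delta>. (x \<bullet> cw \<eta>) *\<^sub>R \<eta>) = (\<Sum>\<eta>\<in>\<Delta>. (y \<bullet> cw \<eta>) *\<^sub>R \<eta>)"
    using assms by simp
  then show ?thesis by (simp only: simple_expansion)
qed

lemma root_signs:
  "\<beta> \<in> \<Phi> \<Longrightarrow> (\<forall>\<eta>\<in>\<Delta>. \<beta> \<bullet> cw \<eta> \<ge> 0) \<or> (\<forall>\<eta>\<in>\<Delta>. \<beta> \<bullet> cw \<eta> \<le> 0)"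
  using simple_system by (auto simp: simple_system_def representation_eq_inner_cw)

lemma root_signs_pos:
  "\<beta> \<in> \<Phi> \<Longrightarrow> \<eta> \<in> \<Delta> \<Longrightarrow> \<beta> \<bullet> cw \<eta> > 0 \<Longrightarrow> \<kappa> \<in> \<Delta> \<Longrightarrow> \<beta> \<bullet> cw \<kappa> \<ge> 0"
  using root_signs[of \<beta>] by force

text \<open>Reflecting \<open>\<eta>\<close> in \<open>\<kappa>\<close> keeps the
  \<open>\<eta>\<close>-coordinate 1, so the sign rule for roots makes the new
  \<open>\<kappa>\<close>-coordinate \<open>- (\<eta> \<bullet> coroot \<kappa>)\<close>
  nonnegative.\<close>

lemma simple_inner_nonpos:
  assumes "\<eta> \<in> \<Delta>" "\<kappa> \<in> \<Delta>" "\<eta> \<noteq> \<kappa>" shows "\<eta> \<bullet> \<kappa> \<le> 0"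
proof -
  let ?\<beta> = "root_reflection \<kappa> \<eta>"
  have "?\<beta> \<bullet> cw \<eta> = 1" "?\<beta> \<bullet> cw \<kappa> = - (\<eta> \<bullet> coroot \<kappa>)"
    using assms by (auto simp: inner_root_reflection inner_cw)
  with root_signs_pos[of ?\<beta> \<eta> \<kappa>] assms have "\<eta> \<bullet> coroot \<kappa> \<le> 0"
    by (simp add: reflection_root simple_root)
  then have "2 * (\<eta> \<bullet> \<kappa>) / (\<kappa> \<bullet> \<kappa>) \<le> 0" by (simp add: coroot_def)
  with root_inner_pos[OF simple_root[OF assms(2)]] show ?thesis
    by (auto simp: divide_le_0_iff simp flip: not_less)
qed

text \<open>In matrix terms, the inverse of a Cartan matrix has no negative entries. Split
  \<open>x = a - b\<close> by the sign of the coordinates: dominance gives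
  \<open>x \<bullet> b \<ge> 0\<close>, nonpositive products of distinct simple roots give
  \<open>a \<bullet> b \<le> 0\<close>, and so \<open>b \<bullet> b \<le> 0\<close>.\<close>

lemma dominant_imp_nonneg_coordinates:
  assumes "J \<subseteq> \<Delta>" "x \<in> span J" "\<And>\<kappa>. \<kappa> \<in> J \<Longrightarrow> x \<bullet> \<kappa> \<ge> 0" "\<eta> \<in> \<Delta>"
  shows "x \<bullet> cw \<eta> \<ge> 0"
proof (rule ccontr)
  assume neg: "\<not> x \<bullet> cw \<eta> \<ge> 0"
  define N where "N = {\<kappa>\<in>J. x \<bullet> cw \<kappa> < 0}"
  define b where "b = (\<Sum>\<kappa>\<in>N. (- (x \<bullet> cw \<kappa>)) *\<^sub>R \<kappa>)"
  define a where "a = (\<Sum>\<kappa>\<in>J - N. (x \<bullet> cw \<kappa>) *\<^sub>R \<kappa>)"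
  have fin: "finite J" using assms(1) finite_simple finite_subset by blast
  have N: "N \<subseteq> J" by (auto simp: N_def)
  have "x = (\<Sum>\<kappa>\<in>J. (x \<bullet> cw \<kappa>) *\<^sub>R \<kappa>)" using subset_expansion[OF assms(1,2)] by (rule sym)
  also have "\<dots> = a - b"
    using sum.subset_diff[OF N fin, of "\<lambda>\<kappa>. (x \<bullet> cw \<kappa>) *\<^sub>R \<kappa>"]
    by (simp add: a_def b_def sum_negf)
  finally have x: "x = a - b" .
  have "x \<bullet> b \<ge> 0"
    using N assms(3) by (auto simp: b_def inner_sum_right N_def intro!: sum_nonneg mult_nonpos_nonneg)
  moreover have "a \<bullet> b \<le> 0"
    unfolding a_def b_def inner_sum_left inner_sum_right
  proof (intro sum_nonpos)
    fix i j assume ij: "i \<in> J - N" "j \<in> N"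
    then have "i \<bullet> j \<le> 0" using simple_inner_nonpos[of i j] assms(1) N by blast
    moreover have "x \<bullet> cw i \<ge> 0" "- (x \<bullet> cw j) \<ge> 0" using ij by (auto simp: N_def)
    ultimately show "((x \<bullet> cw i) *\<^sub>R i) \<bullet> ((- (x \<bullet> cw j)) *\<^sub>R j) \<le> 0"
      by (simp add: mult_nonneg_nonpos mult_nonpos_nonpos mult_nonneg_nonpos2 zero_le_mult_iff mult_le_0_iff)
  qed
  ultimately have "b \<bullet> b \<le> 0" using x by (simp add: inner_diff_left)
  then have "b = 0" by (metis inner_gt_zero_iff not_le)
  have "\<eta> \<in> N" using neg assms(1,2,4) mem_span_subset_iff[of J x] by (cases "\<eta> \<in> J") (auto simp: N_def)
  then have "b \<bullet> cw \<eta> = - (x \<bullet> cw \<eta>)"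
    unfolding b_def using inner_sum_cw[of N \<eta> "\<lambda>\<kappa>. - (x \<bullet> cw \<kappa>)"] N assms(1,4) by auto
  with \<open>b = 0\<close> neg show False by simp
qed

section \<open>Positive roots and differences of roots\<close>

definition positive_roots :: "'a set" where
  "positive_roots = {\<beta>\<in>\<Phi>. \<forall>\<eta>\<in>\<Delta>. \<beta> \<bullet> cw \<eta> \<ge> 0}"

lemma positive_root_or_minus: "\<beta> \<in> \<Phi> \<Longrightarrow> \<beta> \<in> positive_roots \<or> - \<beta> \<in> positive_roots"
  using root_signs[of \<beta>] minus_root[of \<beta>] by (auto simp: positive_roots_def)

text \<open>By reducedness a positive root other than \<open>\<eta>\<close> has a positive
  coordinate off \<open>\<eta>\<close>. The reflection leaves that coordinate alone, and one
  positive coordinate decides the sign of all.\<close>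

lemma simple_reflection_positive:
  assumes "\<beta> \<in> positive_roots" "\<eta> \<in> \<Delta>" "\<beta> \<noteq> \<eta>"
  shows "root_reflection \<eta> \<beta> \<in> positive_roots"
proof -
  have \<beta>: "\<beta> \<in> \<Phi>" "\<And>\<kappa>. \<kappa> \<in> \<Delta> \<Longrightarrow> \<beta> \<bullet> cw \<kappa> \<ge> 0"
    using assms by (auto simp: positive_roots_def)
  have "\<exists>\<kappa>\<in>\<Delta>. \<kappa> \<noteq> \<eta> \<and> \<beta> \<bullet> cw \<kappa> > 0"
  proof (rule ccontr)
    assume "\<not> ?thesis"
    then have "\<beta> = (\<beta> \<bullet> cw \<eta>) *\<^sub>R \<eta>"
      using \<beta>(2) assms(2) by (intro eqI_cw) (force simp: inner_cw intro: antisym)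
    with reduced[of \<eta> "\<beta> \<bullet> cw \<eta>"] \<beta> assms(2) have "\<beta> \<bullet> cw \<eta> = 1"
      by (fastforce simp: simple_root)
    with \<open>\<beta> = (\<beta> \<bullet> cw \<eta>) *\<^sub>R \<eta>\<close> assms(3) show False by simp
  qed
  then obtain \<kappa> where \<kappa>: "\<kappa> \<in> \<Delta>" "\<kappa> \<noteq> \<eta>" "\<beta> \<bullet> cw \<kappa> > 0" by blast
  then have "root_reflection \<eta> \<beta> \<bullet> cw \<kappa> > 0"
    using assms(2) by (simp add: inner_root_reflection inner_cw)
  with root_signs_pos[OF _ \<kappa>(1) this] \<beta>(1) assms(2) show ?thesis
    by (auto simp: positive_roots_def reflection_root simple_root)
qed

text \<open>The two Cartan integers are positive with product below 4, by strict Cauchy-Schwarz. One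
  of them is therefore 1, and the corresponding reflection produces the difference up to
  sign.\<close>

lemma root_diff_of_inner_pos:
  assumes "\<beta> \<in> \<Phi>" "\<gamma> \<in> \<Phi>" "\<beta> \<bullet> \<gamma> > 0" "\<beta> \<noteq> \<gamma>"
  shows "\<beta> - \<gamma> \<in> \<Phi>"
proof -
  have b: "\<beta> \<bullet> \<beta> > 0" "\<gamma> \<bullet> \<gamma> > 0" using root_inner_pos assms by auto
  obtain m n :: int where mn: "\<beta> \<bullet> coroot \<gamma> = m" "\<gamma> \<bullet> coroot \<beta> = n"
    using cartan_int assms by (metis Ints_cases)
  have m: "2 * (\<beta> \<bullet> \<gamma>) = m * (\<gamma> \<bullet> \<gamma>)" and n: "2 * (\<beta> \<bullet> \<gamma>) = n * (\<beta> \<bullet> \<beta>)"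
    using mn b by (auto simp: coroot_def field_simps inner_commute)
  have "real_of_int m * (\<gamma> \<bullet> \<gamma>) > 0" "real_of_int n * (\<beta> \<bullet> \<beta>) > 0" using assms m n by linarith+
  then have mn_pos: "m > 0" "n > 0" using b by (simp_all add: zero_less_mult_iff)
  have "(\<beta> \<bullet> \<gamma>)\<^sup>2 \<noteq> (\<beta> \<bullet> \<beta>) * (\<gamma> \<bullet> \<gamma>)"
  proof
    assume "(\<beta> \<bullet> \<gamma>)\<^sup>2 = (\<beta> \<bullet> \<beta>) * (\<gamma> \<bullet> \<gamma>)"
    \<comment> \<open>The coefficient of the projection of \<open>\<gamma>\<close> to the line of
      \<open>\<beta>\<close>. The squared norm of the remainder is the Cauchy-Schwarz defect divided
      by \<open>\<beta> \<bullet> \<beta>\<close>, so equality makes the roots proportional.\<close>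
    define c where "c = (\<beta> \<bullet> \<gamma>) / (\<beta> \<bullet> \<beta>)"
    have c: "c > 0" using b assms(3) by (simp add: c_def)
    have "(\<gamma> - c *\<^sub>R \<beta>) \<bullet> (\<gamma> - c *\<^sub>R \<beta>) = \<gamma> \<bullet> \<gamma> - 2 * c * (\<beta> \<bullet> \<gamma>) + c\<^sup>2 * (\<beta> \<bullet> \<beta>)"
      by (simp add: inner_diff_left inner_diff_right inner_commute power2_eq_square)
    also have "\<dots> = \<gamma> \<bullet> \<gamma> - (\<beta> \<bullet> \<gamma>)\<^sup>2 / (\<beta> \<bullet> \<beta>)"
      using b(1) by (simp add: c_def power2_eq_square)
    also have "\<dots> = 0" using \<open>(\<beta> \<bullet> \<gamma>)\<^sup>2 = _\<close> b(1) by simp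
    finally have g: "\<gamma> = c *\<^sub>R \<beta>" by simp
    moreover have "c = 1" using reduced[OF assms(1), of c] assms(2) c by (auto simp flip: g)
    ultimately show False using assms(4) by simp
  qed
  with Cauchy_Schwarz_ineq[of \<beta> \<gamma>] have "(\<beta> \<bullet> \<gamma>)\<^sup>2 < (\<beta> \<bullet> \<beta>) * (\<gamma> \<bullet> \<gamma>)" by simp
  moreover have "4 * (\<beta> \<bullet> \<gamma>)\<^sup>2 = (m * n) * ((\<beta> \<bullet> \<beta>) * (\<gamma> \<bullet> \<gamma>))"
  proof -
    have "4 * (\<beta> \<bullet> \<gamma>)\<^sup>2 = (2 * (\<beta> \<bullet> \<gamma>)) * (2 * (\<beta> \<bullet> \<gamma>))" by (simp add: power2_eq_square)
    also have "\<dots> = (m * (\<gamma> \<bullet> \<gamma>)) * (n * (\<beta> \<bullet> \<beta>))" using m n by simp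
    finally show ?thesis by simp
  qed
  ultimately have "real_of_int (m * n) * ((\<beta> \<bullet> \<beta>) * (\<gamma> \<bullet> \<gamma>)) < 4 * ((\<beta> \<bullet> \<beta>) * (\<gamma> \<bullet> \<gamma>))" by linarith
  then have "real_of_int (m * n) < 4" using b by (simp add: mult_less_cancel_right)
  then have "m * n < 4" by linarith
  have "m = 1 \<or> n = 1"
  proof (rule ccontr)
    assume "\<not> ?thesis"
    then have "m \<ge> 2" "n \<ge> 2" using mn_pos by auto
    then have "2 * 2 \<le> m * n" by (intro mult_mono) auto
    with \<open>m * n < 4\<close> show False by simp
  qed
  then show ?thesis
  proof
    assume "m = 1"
    then have "root_reflection \<gamma> \<beta> = \<beta> - \<gamma>" using mn by (simp add: root_reflection_def)
    then show ?thesis using reflection_root assms by metis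
  next
    assume "n = 1"
    then have "- root_reflection \<beta> \<gamma> = \<beta> - \<gamma>" using mn by (simp add: root_reflection_def)
    then show ?thesis using reflection_root minus_root assms by metis
  qed
qed

end

section \<open>Parabolic subsystems and their components\<close>

lemma root_subsystemI:
  assumes "\<Psi> \<subseteq> \<Phi>" "\<And>\<beta> \<gamma>. \<beta> \<in> \<Psi> \<Longrightarrow> \<gamma> \<in> \<Psi> \<Longrightarrow> root_reflection \<beta> \<gamma> \<in> \<Psi>"
  shows "root_subsystem \<Phi> \<Psi>"
  unfolding root_subsystem_def
proof (intro conjI ballI)
  fix \<beta> assume \<beta>: "\<beta> \<in> \<Psi>"
  show "root_reflection \<beta> ` \<Psi> = \<Psi>"
  proof
    show "root_reflection \<beta> ` \<Psi> \<subseteq> \<Psi>" using assms(2) \<beta> by blast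
    show "\<Psi> \<subseteq> root_reflection \<beta> ` \<Psi>"
      using assms(2)[OF \<beta>] root_reflection_involution by (metis image_eqI subsetI)
  qed
qed (rule assms(1))

lemma root_subsystem_reflection:
  assumes "root_subsystem \<Phi> \<Psi>" "\<beta> \<in> \<Psi>" "root_reflection \<beta> \<gamma> \<in> \<Psi>"
  shows "\<gamma> \<in> \<Psi>"
  using assms root_reflection_involution unfolding root_subsystem_def by (metis image_eqI)

lemma root_reflection_span:
  "\<beta> \<in> span J \<Longrightarrow> x \<in> span J \<Longrightarrow> root_reflection \<beta> x \<in> span J"
  unfolding root_reflection_def by (intro span_diff span_scale)

lemma orthogonal_spans:
  fixes A B :: "'a::euclidean_space set"
  assumes "\<And>a b. a \<in> A \<Longrightarrow> b \<in> B \<Longrightarrow> a \<bullet> b = 0" "x \<in> span A" "y \<in> span B"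
  shows "x \<bullet> y = 0"
proof -
  have "orthogonal y a" if "a \<in> A" for a
    using assms(1)[OF that] assms(3) orthogonal_to_span[of y B a]
    by (auto simp: orthogonal_def inner_commute)
  from orthogonal_to_span[OF assms(2) this] show ?thesis
    by (simp add: orthogonal_def inner_commute)
qed

lemma root_reflection_orthogonal: "x \<bullet> \<beta> = 0 \<Longrightarrow> root_reflection \<beta> x = x"
  by (simp add: root_reflection_def coroot_def)

text \<open>Otherwise a link inside one component would lead out of the intersection, although the
  other component is orthogonal to its complement. This gives the definite description in
  \<open>component_roots\<close> its meaning.\<close>

lemma irreducible_component_unique:
  assumes "irreducible_component \<Psi> C" "irreducible_component \<Psi> C'" "x \<in> C" "x \<in> C'"
  shows "C = C'"
proof -
  have "C \<subseteq> C'" if C: "irreducible_component \<Psi> C" "irreducible_component \<Psi> C'" "x \<in> C" "x \<in> C'" for C C'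
  proof (rule ccontr)
    assume "\<not> C \<subseteq> C'"
    then have ne: "C \<inter> C' \<noteq> C" "C \<inter> C' \<noteq> {}" using C by auto
    have irr: "irreducible_roots C" using C(1) by (simp add: irreducible_component_def)
    obtain a b where "a \<in> C \<inter> C'" "b \<in> C - C \<inter> C'" "a \<bullet> b \<noteq> 0"
      by (rule irreducible_roots_linkD[OF irr _ ne(2,1)]) auto
    with C(1,2) show False by (auto simp: irreducible_component_def)
  qed
  from this[OF assms] this[OF assms(2,1,4,3)] show ?thesis by blast
qed

section \<open>Connected components of the Dynkin diagram\<close>

definition simple_component :: "'a::euclidean_space set \<Rightarrow> 'a \<Rightarrow> 'a set" where
  "simple_component I \<epsilon> = {\<eta>. (\<epsilon>, \<eta>) \<in> (dynkin_edges I)\<^sup>*}"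

lemma self_in_simple_component: "\<epsilon> \<in> simple_component I \<epsilon>"
  by (simp add: simple_component_def)

lemma simple_component_subset:
  assumes "\<epsilon> \<in> I" shows "simple_component I \<epsilon> \<subseteq> I"
proof
  fix \<eta> assume "\<eta> \<in> simple_component I \<epsilon>"
  then have "(\<epsilon>, \<eta>) \<in> (dynkin_edges I)\<^sup>*" by (simp add: simple_component_def)
  then show "\<eta> \<in> I" by (induction rule: rtrancl_induct) (auto simp: assms dynkin_edges_def)
qed

lemma simple_component_orthogonal:
  assumes "\<epsilon> \<in> I" "a \<in> simple_component I \<epsilon>" "b \<in> I - simple_component I \<epsilon>"
  shows "a \<bullet> b = 0"
proof (rule ccontr)
  assume "a \<bullet> b \<noteq> 0"
  with assms simple_component_subset[OF assms(1)] have "(a, b) \<in> dynkin_edges I"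
    by (auto simp: dynkin_edges_def)
  with assms(2) have "b \<in> simple_component I \<epsilon>"
    by (auto simp: simple_component_def)
  with assms(3) show False by blast
qed

text \<open>In an orthogonal splitting no edge leaves the part that contains
  \<open>\<epsilon>\<close>, so no path from \<open>\<epsilon>\<close> reaches the other
  part.\<close>

lemma irreducible_simple_component:
  assumes "\<epsilon> \<in> I" shows "irreducible_roots (simple_component I \<epsilon>)"
proof -
  let ?J = "simple_component I \<epsilon>"
  have *: "?J \<subseteq> A" if AB: "A \<union> B = ?J" "\<epsilon> \<in> A" "\<And>a b. a \<in> A \<Longrightarrow> b \<in> B \<Longrightarrow> a \<bullet> b = 0" for A B
  proof
    fix \<eta> assume "\<eta> \<in> ?J"
    then have "(\<epsilon>, \<eta>) \<in> (dynkin_edges I)\<^sup>*" by (simp add: simple_component_def)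
    then show "\<eta> \<in> A"
    proof (induction rule: rtrancl_induct)
      case base show ?case by (rule AB(2))
    next
      case (step y z)
      then have "z \<in> ?J" by (auto simp: simple_component_def)
      moreover have "y \<bullet> z \<noteq> 0" using step by (auto simp: dynkin_edges_def)
      ultimately show ?case using AB(1) AB(3)[OF step.IH] by blast
    qed
  qed
  show ?thesis
    unfolding irreducible_roots_def
  proof (intro conjI notI)
    show "?J = {} \<Longrightarrow> False" using self_in_simple_component by blast
    assume "\<exists>A B. A \<noteq> {} \<and> B \<noteq> {} \<and> A \<union> B = ?J \<and> A \<inter> B = {} \<and> (\<forall>a\<in>A. \<forall>b\<in>B. a \<bullet> b = 0)"
    then obtain A B where AB: "A \<noteq> {}" "B \<noteq> {}" "A \<union> B = ?J" "A \<inter> B = {}"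
      and "\<forall>a\<in>A. \<forall>b\<in>B. a \<bullet> b = 0" by (elim exE conjE) (rule that)
    then have orth: "\<And>a b. a \<in> A \<Longrightarrow> b \<in> B \<Longrightarrow> a \<bullet> b = 0" by blast
    have BA: "B \<union> A = ?J" using AB(3) by blast
    have "\<epsilon> \<in> A \<or> \<epsilon> \<in> B" using AB(3) self_in_simple_component by blast
    then show False
    proof
      assume "\<epsilon> \<in> A"
      from *[OF AB(3) this orth] AB show False by blast
    next
      assume "\<epsilon> \<in> B"
      from *[OF BA this] orth AB show False by (metis Un_upper1 disjoint_iff inner_commute subset_empty subset_eq)
    qed
  qed
qed

context simple_roots
begin

lemma inner_subset_expansion:
  assumes "J \<subseteq> \<Delta>" "x \<in> span J" shows "y \<bullet> x = (\<Sum>\<eta>\<in>J. (x \<bullet> cw \<eta>) * (y \<bullet> \<eta>))"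
proof -
  have "y \<bullet> x = y \<bullet> (\<Sum>\<eta>\<in>J. (x \<bullet> cw \<eta>) *\<^sub>R \<eta>)"
    by (simp only: subset_expansion[OF assms])
  then show ?thesis by (simp add: inner_sum_right)
qed

definition height :: "'a \<Rightarrow> real" where "height x = (\<Sum>\<eta>\<in>\<Delta>. x \<bullet> cw \<eta>)"

lemma height_reflection:
  assumes "\<eta> \<in> \<Delta>" shows "height (root_reflection \<eta> x) = height x - x \<bullet> coroot \<eta>"
proof -
  have "height \<eta> = 1" using assms finite_simple by (simp add: height_def inner_cw)
  moreover have "height (root_reflection \<eta> x) = height x - (x \<bullet> coroot \<eta>) * height \<eta>"
    by (simp add: height_def inner_root_reflection sum_subtractf sum_distrib_left)
  ultimately show ?thesis by simp
qed

lemma height_positive: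
  assumes "\<beta> \<in> positive_roots" shows "height \<beta> > 0"
proof -
  have \<beta>: "\<beta> \<in> \<Phi>" "\<And>\<eta>. \<eta> \<in> \<Delta> \<Longrightarrow> \<beta> \<bullet> cw \<eta> \<ge> 0" using assms by (auto simp: positive_roots_def)
  have "\<exists>\<eta>\<in>\<Delta>. \<beta> \<bullet> cw \<eta> \<noteq> 0"
    using eqI_cw[of \<beta> 0] \<beta>(1) zero_not_root by auto
  with \<beta>(2) show ?thesis
    unfolding height_def using finite_simple by (metis order_less_le sum_pos2)
qed

lemma inner_coroot_pos_iff: "\<beta> \<in> \<Phi> \<Longrightarrow> x \<bullet> coroot \<beta> > 0 \<longleftrightarrow> x \<bullet> \<beta> > 0"
  and inner_coroot_neg_iff: "\<beta> \<in> \<Phi> \<Longrightarrow> x \<bullet> coroot \<beta> < 0 \<longleftrightarrow> x \<bullet> \<beta> < 0"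
  using root_inner_pos[of \<beta>] by (auto simp: coroot_def zero_less_mult_iff mult_less_0_iff zero_less_divide_iff divide_less_0_iff
      leD[OF inner_ge_zero])

lemma parabolic_root_subsystem: "root_subsystem \<Phi> (\<Phi> \<inter> span J)"
  by (rule root_subsystemI) (auto simp: reflection_root root_reflection_span)

text \<open>Take a positive counterexample of least height. Its squared length is a nonnegative
  combination of its products with \<open>J\<close>, so one of these is positive; reflecting there
  lowers the height, keeps the root positive and brings it into \<open>\<Psi>\<close>, which is
  stable under that reflection.\<close>

lemma parabolic_roots_subset_subsystem:
  assumes "J \<subseteq> \<Delta>" "root_subsystem \<Phi> \<Psi>" "J \<subseteq> \<Psi>"
  shows "\<Phi> \<inter> span J \<subseteq> \<Psi>"
proof -
  have pos: "\<beta> \<in> \<Psi>" if "\<beta> \<in> positive_roots" "\<beta> \<in> span J" for \<beta>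
  proof (rule ccontr)
    assume "\<beta> \<notin> \<Psi>"
    define S where "S = {\<beta>\<in>positive_roots. \<beta> \<in> span J \<and> \<beta> \<notin> \<Psi>}"
    have "finite S" using finite_roots by (auto simp: S_def positive_roots_def)
    moreover have "S \<noteq> {}" using that \<open>\<beta> \<notin> \<Psi>\<close> by (auto simp: S_def)
    ultimately obtain \<gamma> where \<gamma>: "\<gamma> \<in> S" and min: "\<And>\<delta>. \<delta> \<in> S \<Longrightarrow> height \<gamma> \<le> height \<delta>"
      using ex_min_if_finite[of "height ` S"] by (force simp: not_less)
    have \<gamma>': "\<gamma> \<in> \<Phi>" "\<gamma> \<in> positive_roots" "\<gamma> \<in> span J" "\<gamma> \<notin> \<Psi>"
      using \<gamma> by (auto simp: S_def positive_roots_def)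
    have "\<exists>\<eta>\<in>J. \<gamma> \<bullet> \<eta> > 0"
    proof (rule ccontr)
      assume "\<not> ?thesis"
      then have "(\<Sum>\<eta>\<in>J. (\<gamma> \<bullet> cw \<eta>) * (\<gamma> \<bullet> \<eta>)) \<le> 0"
        using \<gamma>'(2) assms(1) by (intro sum_nonpos mult_nonneg_nonpos) (force simp: positive_roots_def)+
      with inner_subset_expansion[OF assms(1) \<gamma>'(3), of \<gamma>] root_inner_pos[OF \<gamma>'(1)]
      show False by simp
    qed
    then obtain \<eta> where \<eta>: "\<eta> \<in> J" "\<gamma> \<bullet> \<eta> > 0" by blast
    then have "\<eta> \<in> \<Delta>" "\<gamma> \<noteq> \<eta>" using assms \<gamma>'(4) by auto
    then have "height (root_reflection \<eta> \<gamma>) < height \<gamma>"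
      using height_reflection[of \<eta> \<gamma>] inner_coroot_pos_iff[of \<eta> \<gamma>] \<eta> by (simp add: simple_root)
    then have "root_reflection \<eta> \<gamma> \<notin> S" using min by (simp add: not_le[symmetric]) blast
    then have "root_reflection \<eta> \<gamma> \<in> \<Psi>"
      using simple_reflection_positive[OF \<gamma>'(2) \<open>\<eta> \<in> \<Delta>\<close> \<open>\<gamma> \<noteq> \<eta>\<close>]
        root_reflection_span[of \<eta> J \<gamma>] \<gamma>'(3) span_base[OF \<eta>(1)] by (simp add: S_def)
    with root_subsystem_reflection[OF assms(2)] \<eta>(1) assms(3) \<gamma>'(4) show False by blast
  qed
  show ?thesis
  proof
    fix \<beta> assume \<beta>: "\<beta> \<in> \<Phi> \<inter> span J"
    then consider "\<beta> \<in> positive_roots" | "- \<beta> \<in> positive_roots"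
      using positive_root_or_minus by blast
    then show "\<beta> \<in> \<Psi>"
    proof cases
      case 2
      then have "- \<beta> \<in> \<Psi>" using pos \<beta> span_neg[of \<beta> J] by blast
      moreover have "root_reflection (- \<beta>) \<beta> = - \<beta>"
        using root_reflection_self[of \<beta>] by (simp add: root_reflection_def coroot_def)
      ultimately show ?thesis using root_subsystem_reflection[OF assms(2), of "- \<beta>" \<beta>] by simp
    qed (use pos \<beta> in blast)
  qed
qed

lemma root_subsystem_hull:
  assumes "J \<subseteq> \<Delta>" shows "root_subsystem \<Phi> hull J = \<Phi> \<inter> span J"
  using assms simple_subset parabolic_root_subsystem parabolic_roots_subset_subsystem
  by (intro hull_unique) (auto simp: span_base)

text \<open>Reflections in one part fix the other, so the roots in the union of the two spans form a
  subsystem. It contains \<open>I\<close>, and \<open>I\<close> generates all roots of its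
  span.\<close>

lemma root_in_orthogonal_part:
  assumes "I \<subseteq> \<Delta>" "J \<subseteq> I" "\<And>a b. a \<in> J \<Longrightarrow> b \<in> I - J \<Longrightarrow> a \<bullet> b = 0"
    and "\<beta> \<in> \<Phi>" "\<beta> \<in> span I"
  shows "\<beta> \<in> span J \<or> \<beta> \<in> span (I - J)"
proof -
  let ?\<Psi> = "\<Phi> \<inter> (span J \<union> span (I - J))"
  have orth: "x \<bullet> y = 0" "y \<bullet> x = 0" if "x \<in> span J" "y \<in> span (I - J)" for x y
    using orthogonal_spans[OF assms(3) that] by (auto simp: inner_commute)
  have "root_subsystem \<Phi> ?\<Psi>"
  proof (rule root_subsystemI)
    fix \<beta> \<gamma> assume "\<beta> \<in> ?\<Psi>" "\<gamma> \<in> ?\<Psi>"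
    then show "root_reflection \<beta> \<gamma> \<in> ?\<Psi>"
      using orth by (auto simp: reflection_root root_reflection_span root_reflection_orthogonal)
  qed auto
  moreover have "I \<subseteq> ?\<Psi>" using assms(1) simple_subset by (auto intro: span_base)
  ultimately show ?thesis using parabolic_roots_subset_subsystem[OF assms(1)] assms(4,5) by blast
qed

lemma simple_inter_span:
  assumes "J \<subseteq> \<Delta>" shows "\<Delta> \<inter> span J = J"
proof -
  have "\<eta> \<in> J" if "\<eta> \<in> \<Delta>" "\<eta> \<in> span J" for \<eta>
    using that inner_cw(2)[of \<eta> \<eta>] mem_span_subset_iff[OF assms, of \<eta>] by force
  then show ?thesis using assms by (auto intro: span_base)
qed

text \<open>An orthogonal splitting of the roots cannot cut the connected set \<open>J\<close>. One
  side contains \<open>J\<close>, and the other is orthogonal to \<open>span J\<close>, hence to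
  itself.\<close>

lemma irreducible_parabolic:
  assumes "J \<subseteq> \<Delta>" "irreducible_roots J" shows "irreducible_roots (\<Phi> \<inter> span J)"
  unfolding irreducible_roots_def
proof (intro conjI notI)
  have J: "J \<subseteq> \<Phi> \<inter> span J" using assms(1) simple_subset by (auto intro: span_base)
  then show "\<Phi> \<inter> span J = {} \<Longrightarrow> False" using assms(2) by (auto simp: irreducible_roots_def)
  assume "\<exists>A B. A \<noteq> {} \<and> B \<noteq> {} \<and> A \<union> B = \<Phi> \<inter> span J \<and> A \<inter> B = {} \<and> (\<forall>a\<in>A. \<forall>b\<in>B. a \<bullet> b = 0)"
  then obtain A B where AB: "A \<noteq> {}" "B \<noteq> {}" "A \<union> B = \<Phi> \<inter> span J" "A \<inter> B = {}"
    and "\<forall>a\<in>A. \<forall>b\<in>B. a \<bullet> b = 0" by (elim exE conjE) (rule that)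
  then have orth: "\<And>a b. a \<in> A \<Longrightarrow> b \<in> B \<Longrightarrow> a \<bullet> b = 0" by blast
  have *: False if "J \<subseteq> X" "Y \<noteq> {}" "Y \<subseteq> \<Phi> \<inter> span J" "\<And>a b. a \<in> X \<Longrightarrow> b \<in> Y \<Longrightarrow> a \<bullet> b = 0" for X Y
  proof -
    obtain y where "y \<in> Y" using \<open>Y \<noteq> {}\<close> by blast
    have "y \<bullet> y = 0"
    proof (rule orthogonal_spans)
      show "y \<in> span J" using \<open>y \<in> Y\<close> that(3) by blast
      show "y \<in> span {y}" by (simp add: span_base)
      fix a b assume "a \<in> J" "b \<in> {y}"
      then show "a \<bullet> b = 0" using \<open>y \<in> Y\<close> that(1,4) by blast
    qed
    with \<open>y \<in> Y\<close> that(3) zero_not_root show False by auto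
  qed
  show False
  proof (cases "J \<inter> A = {} \<or> J \<inter> A = J")
    case True
    then show False
    proof
      assume "J \<inter> A = {}"
      then have "J \<subseteq> B" using J AB(3) by blast
      then show False by (rule *[OF _ AB(1)]) (use AB(3) orth in \<open>metis Un_upper1 inner_commute\<close>)+
    next
      assume "J \<inter> A = J"
      then have "J \<subseteq> A" by blast
      then show False by (rule *[OF _ AB(2)]) (use AB(3) orth in auto)
    qed
  next
    case False
    then obtain a b where ab: "a \<in> J \<inter> A" "b \<in> J - J \<inter> A" "a \<bullet> b \<noteq> 0"
      using irreducible_roots_linkD[OF assms(2), of "J \<inter> A"] by (metis inf_le1)
    then have "b \<in> B" using J AB(3) by blast
    with ab orth show False by blast
  qed
qed

text \<open>Passes from the abstract component of the root subsystem to a component of the diagram,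
  on which paths can be followed.\<close>

lemma component_roots_eq:
  assumes "\<epsilon> \<in> \<Delta> - {\<alpha>}"
  shows "component_roots \<Phi> \<Delta> \<alpha> \<epsilon> = \<Phi> \<inter> span (simple_component (\<Delta> - {\<alpha>}) \<epsilon>)"
proof -
  let ?I = "\<Delta> - {\<alpha>}" let ?J = "simple_component ?I \<epsilon>" let ?\<Psi> = "\<Phi> \<inter> span ?I"
  have I: "?I \<subseteq> \<Delta>" by blast
  have J: "?J \<subseteq> ?I" by (rule simple_component_subset[OF assms])
  have "irreducible_component ?\<Psi> (\<Phi> \<inter> span ?J)"
    unfolding irreducible_component_def
  proof (intro conjI ballI)
    show "\<Phi> \<inter> span ?J \<subseteq> ?\<Psi>" using span_mono[OF J] by blast
    show "irreducible_roots (\<Phi> \<inter> span ?J)"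
      using J irreducible_simple_component[OF assms] by (intro irreducible_parabolic) auto
    fix x y assume x: "x \<in> \<Phi> \<inter> span ?J" and y: "y \<in> ?\<Psi> - \<Phi> \<inter> span ?J"
    have "y \<in> span ?J \<or> y \<in> span (?I - ?J)"
      using root_in_orthogonal_part[OF I J simple_component_orthogonal[OF assms]] y by blast
    then show "x \<bullet> y = 0"
      using x y orthogonal_spans[OF simple_component_orthogonal[OF assms], where x = x and y = y] by blast
  qed
  then have *: "irreducible_component ?\<Psi> (\<Phi> \<inter> span ?J) \<and> \<epsilon> \<in> \<Phi> \<inter> span ?J"
    using assms simple_subset self_in_simple_component[of \<epsilon> ?I] by (auto intro: span_base)
  then show ?thesis
    unfolding component_roots_def parabolic_subsystem_def root_subsystem_hull[OF I]
  proof (rule the_equality)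
    fix C assume "irreducible_component ?\<Psi> C \<and> \<epsilon> \<in> C"
    with * show "C = \<Phi> \<inter> span ?J" by (metis irreducible_component_unique)
  qed
qed

lemma component_simple_roots_eq:
  assumes "\<epsilon> \<in> \<Delta> - {\<alpha>}"
  shows "component_simple_roots \<Phi> \<Delta> \<alpha> \<epsilon> = simple_component (\<Delta> - {\<alpha>}) \<epsilon>"
  using simple_inter_span[of "simple_component (\<Delta> - {\<alpha>}) \<epsilon>"] simple_component_subset[OF assms] simple_subset
  unfolding component_simple_roots_def component_roots_eq[OF assms] by blast

section \<open>Highest roots\<close>

text \<open>At a vertex \<open>b\<close> outside the support but linked to it,
  \<open>b \<bullet> \<beta>\<close> would be a sum of nonpositive terms with one of them negative,
  against dominance.\<close>

lemma dominant_root_full_support: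
  assumes J: "J \<subseteq> \<Delta>" "irreducible_roots J" and \<beta>: "\<beta> \<in> \<Phi>" "\<beta> \<in> span J"
    and dom: "\<And>\<eta>. \<eta> \<in> J \<Longrightarrow> \<beta> \<bullet> \<eta> \<ge> 0" and \<eta>: "\<eta> \<in> J"
  shows "\<beta> \<bullet> cw \<eta> > 0"
proof -
  have nn: "\<beta> \<bullet> cw \<kappa> \<ge> 0" if "\<kappa> \<in> \<Delta>" for \<kappa>
    using dominant_imp_nonneg_coordinates[OF J(1) \<beta>(2) dom that] .
  define S where "S = {\<kappa>\<in>J. \<beta> \<bullet> cw \<kappa> > 0}"
  have "S \<noteq> {}"
  proof
    assume "S = {}"
    then have "\<beta> \<bullet> cw \<kappa> = 0" if "\<kappa> \<in> \<Delta>" for \<kappa>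
      using nn[OF that] mem_span_subset_iff[OF J(1), of \<beta>] \<beta>(2) that by (cases "\<kappa> \<in> J") (force simp: S_def)+
    then have "\<beta> = 0" by (intro eqI_cw) simp
    with \<beta>(1) zero_not_root show False by simp
  qed
  have "S = J"
  proof (rule ccontr)
    assume "S \<noteq> J"
    moreover have "S \<subseteq> J" by (auto simp: S_def)
    ultimately obtain a b where ab: "a \<in> S" "b \<in> J - S" "a \<bullet> b \<noteq> 0"
      using irreducible_roots_linkD[OF J(2)] \<open>S \<noteq> {}\<close> by metis
    then have "a \<bullet> b < 0" using simple_inner_nonpos[of a b] J(1) \<open>S \<subseteq> J\<close> by force
    have b0: "\<beta> \<bullet> cw b = 0" using ab(2) nn[of b] J(1) by (force simp: S_def)
    have "b \<bullet> \<beta> = (\<Sum>\<kappa>\<in>J. (\<beta> \<bullet> cw \<kappa>) * (b \<bullet> \<kappa>))"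
      by (rule inner_subset_expansion[OF J(1) \<beta>(2)])
    also have "\<dots> < (\<Sum>\<kappa>\<in>J. 0)"
    proof (rule sum_strict_mono_ex1)
      show "finite J" using J(1) finite_simple finite_subset by blast
      show "\<forall>\<kappa>\<in>J. (\<beta> \<bullet> cw \<kappa>) * (b \<bullet> \<kappa>) \<le> 0"
      proof
        fix \<kappa> assume "\<kappa> \<in> J"
        then show "(\<beta> \<bullet> cw \<kappa>) * (b \<bullet> \<kappa>) \<le> 0"
          using nn[of \<kappa>] simple_inner_nonpos[of b \<kappa>] ab(2) b0 J(1)
          by (cases "\<kappa> = b") (auto intro!: mult_nonneg_nonpos)
      qed
      show "\<exists>\<kappa>\<in>J. (\<beta> \<bullet> cw \<kappa>) * (b \<bullet> \<kappa>) < 0"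
        using ab(1) \<open>a \<bullet> b < 0\<close> by (auto simp: S_def inner_commute mult_pos_neg intro!: bexI[of _ a])
    qed
    finally show False using dom[of b] ab(2) by (simp add: inner_commute)
  qed
  with \<eta> show ?thesis by (auto simp: S_def)
qed

text \<open>Greatest height among the roots above \<open>\<beta>\<close> suffices: reflecting in a
  simple root with negative product, or adding a positive root, would go higher. The arbitrary
  starting root \<open>\<beta>\<close> later turns uniqueness of \<open>\<gamma>\<close> into an
  upper bound for all roots.\<close>

lemma maximal_root_above:
  assumes J: "J \<subseteq> \<Delta>" and \<beta>: "\<beta> \<in> \<Phi>" "\<beta> \<in> span J"
  obtains \<gamma> where "\<gamma> \<in> \<Phi>" "\<gamma> \<in> span J" "\<And>\<eta>. \<eta> \<in> \<Delta> \<Longrightarrow> \<beta> \<bullet> cw \<eta> \<le> \<gamma> \<bullet> cw \<eta>"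
    "\<And>\<eta>. \<eta> \<in> J \<Longrightarrow> \<gamma> \<bullet> \<eta> \<ge> 0"
    "\<And>\<kappa>. \<kappa> \<in> positive_roots \<Longrightarrow> \<kappa> \<in> span J \<Longrightarrow> \<gamma> + \<kappa> \<notin> \<Phi>"
proof -
  define U where "U = {\<gamma>\<in>\<Phi>. \<gamma> \<in> span J \<and> (\<forall>\<eta>\<in>\<Delta>. \<beta> \<bullet> cw \<eta> \<le> \<gamma> \<bullet> cw \<eta>)}"
  have fin: "finite (height ` U)" "height ` U \<noteq> {}" using finite_roots \<beta> by (auto simp: U_def)
  then obtain \<gamma> where \<gamma>: "\<gamma> \<in> U" "height \<gamma> = Max (height ` U)"
    using Max_in[of "height ` U"] by (metis imageE)
  then have max: "height \<delta> \<le> height \<gamma>" if "\<delta> \<in> U" for \<delta>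
    using Max_ge[OF fin(1)] that by simp
  have \<gamma>': "\<gamma> \<in> \<Phi>" "\<gamma> \<in> span J" "\<And>\<eta>. \<eta> \<in> \<Delta> \<Longrightarrow> \<beta> \<bullet> cw \<eta> \<le> \<gamma> \<bullet> cw \<eta>"
    using \<gamma>(1) by (auto simp: U_def)
  moreover have "\<gamma> \<bullet> \<eta> \<ge> 0" if \<eta>: "\<eta> \<in> J" for \<eta>
  proof (rule ccontr)
    assume "\<not> \<gamma> \<bullet> \<eta> \<ge> 0"
    then have neg: "\<gamma> \<bullet> coroot \<eta> < 0"
      using inner_coroot_neg_iff[of \<eta> \<gamma>] \<eta> J simple_subset by force
    have "root_reflection \<eta> \<gamma> \<bullet> cw \<kappa> \<ge> \<gamma> \<bullet> cw \<kappa>" if "\<kappa> \<in> \<Delta>" for \<kappa>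
      using neg \<eta> J by (auto simp: inner_root_reflection inner_cw subset_iff)
    then have "root_reflection \<eta> \<gamma> \<in> U"
      using \<gamma>' \<eta> J simple_subset
      by (auto simp: U_def span_base intro!: reflection_root root_reflection_span order_trans[OF \<gamma>'(3)])
    from max[OF this] height_reflection[of \<eta> \<gamma>] neg \<eta> J show False by auto
  qed
  moreover have "\<gamma> + \<kappa> \<notin> \<Phi>" if \<kappa>: "\<kappa> \<in> positive_roots" "\<kappa> \<in> span J" for \<kappa>
  proof
    assume "\<gamma> + \<kappa> \<in> \<Phi>"
    then have "\<gamma> + \<kappa> \<in> U"
      using \<gamma>' \<kappa> by (auto simp: U_def span_add positive_roots_def inner_add_left add_increasing2)
    from max[OF this] height_positive[OF \<kappa>(1)] show False
      by (simp add: height_def inner_add_left sum.distrib)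
  qed
  ultimately show ?thesis using that by blast
qed

text \<open>Full support of \<open>\<gamma>\<close> makes \<open>\<beta> \<bullet> \<gamma>\<close>
  positive, so the difference is a root. Whichever sign of it is positive, adding it to one of the
  two roots yields the other, against maximality.\<close>

lemma maximal_root_unique:
  assumes J: "J \<subseteq> \<Delta>" "irreducible_roots J"
    and \<beta>: "\<beta> \<in> \<Phi>" "\<beta> \<in> span J" "\<And>\<eta>. \<eta> \<in> J \<Longrightarrow> \<beta> \<bullet> \<eta> \<ge> 0"
      "\<And>\<kappa>. \<kappa> \<in> positive_roots \<Longrightarrow> \<kappa> \<in> span J \<Longrightarrow> \<beta> + \<kappa> \<notin> \<Phi>"
    and \<gamma>: "\<gamma> \<in> \<Phi>" "\<gamma> \<in> span J" "\<And>\<eta>. \<eta> \<in> J \<Longrightarrow> \<gamma> \<bullet> \<eta> \<ge> 0"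
      "\<And>\<kappa>. \<kappa> \<in> positive_roots \<Longrightarrow> \<kappa> \<in> span J \<Longrightarrow> \<gamma> + \<kappa> \<notin> \<Phi>"
  shows "\<beta> = \<gamma>"
proof (rule ccontr)
  assume ne: "\<beta> \<noteq> \<gamma>"
  have fin: "finite J" using J(1) finite_simple finite_subset by blast
  have "\<exists>\<eta>\<in>J. \<beta> \<bullet> \<eta> > 0"
  proof (rule ccontr)
    assume "\<not> ?thesis"
    then have "\<beta> \<bullet> \<eta> = 0" if "\<eta> \<in> J" for \<eta> using \<beta>(3)[OF that] that by force
    then have "\<beta> \<bullet> \<beta> = 0" using inner_subset_expansion[OF J(1) \<beta>(2), of \<beta>] by simp
    with root_inner_pos[OF \<beta>(1)] show False by simp
  qed
  then obtain \<eta> where \<eta>: "\<eta> \<in> J" "\<beta> \<bullet> \<eta> > 0" by blast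
  have pos: "\<gamma> \<bullet> cw \<kappa> > 0" if "\<kappa> \<in> J" for \<kappa>
    by (rule dominant_root_full_support[OF J \<gamma>(1,2,3) that])
  have "0 < (\<Sum>\<kappa>\<in>J. (\<gamma> \<bullet> cw \<kappa>) * (\<beta> \<bullet> \<kappa>))"
    using fin \<eta>(1) by (rule sum_pos2) (use pos \<beta>(3) \<eta> in \<open>auto intro: mult_nonneg_nonneg less_imp_le\<close>)
  then have "\<beta> \<bullet> \<gamma> > 0" using inner_subset_expansion[OF J(1) \<gamma>(2), of \<beta>] by simp
  from root_diff_of_inner_pos[OF \<beta>(1) \<gamma>(1) this ne] have r: "\<beta> - \<gamma> \<in> \<Phi>" .
  have s: "\<beta> - \<gamma> \<in> span J" "\<gamma> - \<beta> \<in> span J" using \<beta>(2) \<gamma>(2) by (auto intro: span_diff)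
  from positive_root_or_minus[OF r] show False
    using \<beta>(4)[of "\<gamma> - \<beta>"] \<gamma>(4)[of "\<beta> - \<gamma>"] s \<beta>(1) \<gamma>(1) by auto
qed

text \<open>Every root lies below a dominant maximal one, and there is only one of these, so it is
  what the definite description selects. Positivity of its coordinates permits division by the
  marks.\<close>

lemma highest_root:
  assumes J: "J \<subseteq> \<Delta>" "irreducible_roots J"
  defines "\<theta> \<equiv> highest_root (\<Phi> \<inter> span J) J"
  shows "\<theta> \<in> \<Phi>" "\<theta> \<in> span J"
    and "\<beta> \<in> \<Phi> \<Longrightarrow> \<beta> \<in> span J \<Longrightarrow> \<eta> \<in> J \<Longrightarrow> \<beta> \<bullet> cw \<eta> \<le> \<theta> \<bullet> cw \<eta>"
    and "\<eta> \<in> J \<Longrightarrow> \<theta> \<bullet> cw \<eta> > 0"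
proof -
  let ?M = "\<lambda>\<gamma>. \<gamma> \<in> \<Phi> \<and> \<gamma> \<in> span J \<and> (\<forall>\<eta>\<in>J. \<gamma> \<bullet> \<eta> \<ge> 0) \<and>
    (\<forall>\<kappa>\<in>positive_roots. \<kappa> \<in> span J \<longrightarrow> \<gamma> + \<kappa> \<notin> \<Phi>)"
  obtain \<epsilon> where "\<epsilon> \<in> J" using J(2) by (auto simp: irreducible_roots_def)
  then have "\<epsilon> \<in> \<Phi>" "\<epsilon> \<in> span J" using J(1) simple_subset by (auto intro: span_base)
  then obtain \<gamma> where \<gamma>: "?M \<gamma>" using maximal_root_above[OF J(1)] by metis
  have uniq: "\<delta> = \<gamma>" if "?M \<delta>" for \<delta>
    by (rule maximal_root_unique[OF J]) (use that \<gamma> in auto)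
  have above: "\<beta> \<bullet> cw \<eta> \<le> \<gamma> \<bullet> cw \<eta>" if \<beta>: "\<beta> \<in> \<Phi>" "\<beta> \<in> span J" and \<eta>: "\<eta> \<in> \<Delta>" for \<beta> \<eta>
  proof -
    obtain \<delta> where "?M \<delta>" "\<beta> \<bullet> cw \<eta> \<le> \<delta> \<bullet> cw \<eta>" using maximal_root_above[OF J(1) \<beta>] \<eta> by metis
    with uniq show ?thesis by blast
  qed
  have rep: "representation J x \<eta> = x \<bullet> cw \<eta>" if "x \<in> span J" "\<eta> \<in> J" for x \<eta>
    using representation_subset_eq_inner_cw[OF J(1)] that .
  have "\<theta> = \<gamma>"
    unfolding \<theta>_def highest_root_def
  proof (rule the_equality)
    show "\<gamma> \<in> \<Phi> \<inter> span J \<and> (\<forall>\<beta>\<in>\<Phi> \<inter> span J. \<forall>\<eta>\<in>J. representation J \<beta> \<eta> \<le> representation J \<gamma> \<eta>)"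
      using \<gamma> above J(1) by (auto simp: rep)
    fix \<delta> assume \<delta>: "\<delta> \<in> \<Phi> \<inter> span J \<and> (\<forall>\<beta>\<in>\<Phi> \<inter> span J. \<forall>\<eta>\<in>J. representation J \<beta> \<eta> \<le> representation J \<delta> \<eta>)"
    have "\<gamma> \<bullet> cw \<eta> \<le> \<delta> \<bullet> cw \<eta>" if "\<eta> \<in> J" for \<eta>
    proof -
      have "representation J \<gamma> \<eta> \<le> representation J \<delta> \<eta>" using \<gamma> \<delta> that by blast
      then show ?thesis using \<gamma> \<delta> that by (simp add: rep)
    qed
    then have J_eq: "\<delta> \<bullet> cw \<eta> = \<gamma> \<bullet> cw \<eta>" if "\<eta> \<in> J" for \<eta>
      using above[of \<delta> \<eta>] \<delta> J(1) that by (auto intro: antisym)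
    show "\<delta> = \<gamma>"
    proof (rule eqI_cw)
      fix \<eta> assume "\<eta> \<in> \<Delta>"
      then show "\<delta> \<bullet> cw \<eta> = \<gamma> \<bullet> cw \<eta>"
        using J_eq mem_span_subset_iff[OF J(1)] \<delta> \<gamma> by (cases "\<eta> \<in> J") auto
    qed
  qed
  then show "\<theta> \<in> \<Phi>" "\<theta> \<in> span J"
    "\<beta> \<in> \<Phi> \<Longrightarrow> \<beta> \<in> span J \<Longrightarrow> \<eta> \<in> J \<Longrightarrow> \<beta> \<bullet> cw \<eta> \<le> \<theta> \<bullet> cw \<eta>"
    "\<eta> \<in> J \<Longrightarrow> \<theta> \<bullet> cw \<eta> > 0"
    using \<gamma> above[of \<beta> \<eta>] J(1) dominant_root_full_support[OF J, of \<gamma> \<eta>] by auto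
qed

end

section \<open>The diagram and its extremal vertices\<close>

lemma sum_two_terms:
  fixes f :: "'b \<Rightarrow> real"
  assumes "finite J" "a \<in> J" "b \<in> J" "a \<noteq> b" "\<And>k. k \<in> J \<Longrightarrow> k \<noteq> a \<Longrightarrow> k \<noteq> b \<Longrightarrow> f k = 0"
  shows "sum f J = f a + f b"
proof -
  have "sum f J = sum f {a, b}"
    using assms by (intro sum.mono_neutral_right) auto
  then show ?thesis using assms(4) by simp
qed

lemma sum_le_partial_sum_nonpos:
  fixes f :: "'b \<Rightarrow> real"
  assumes "finite J" "A \<subseteq> J" "\<And>k. k \<in> J - A \<Longrightarrow> f k \<le> 0"
  shows "sum f J \<le> sum f A"
  using sum.subset_diff[OF assms(2,1), of f] sum_nonpos[of "J - A" f] assms(3) by simp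

lemma dynkin_reach_sym: "(x, y) \<in> (dynkin_edges V)\<^sup>* \<Longrightarrow> (y, x) \<in> (dynkin_edges V)\<^sup>*"
  by (rule symD[OF sym_rtrancl]) (auto simp: sym_def dynkin_edges_def inner_commute)

lemma simple_component_disjoint:
  assumes "\<eta> \<in> simple_component I \<epsilon>" "\<eta> \<in> simple_component I \<epsilon>'"
  shows "\<epsilon>' \<in> simple_component I \<epsilon>"
  using assms dynkin_reach_sym[of \<epsilon>' \<eta> I] by (auto simp: simple_component_def)

context simple_roots
begin

text \<open>Linked simple roots enclose at least 120 degrees: both Cartan integers are at most -1,
  so twice the product is at most minus either squared length, and the mean of the squared lengths
  is at least the product of the lengths.\<close>

lemma normalized_inner_le_half:
  assumes "\<eta> \<in> \<Delta>" "\<kappa> \<in> \<Delta>" "\<eta> \<noteq> \<kappa>" "\<eta> \<bullet> \<kappa> \<noteq> 0"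
  shows "sgn \<eta> \<bullet> sgn \<kappa> \<le> - 1 / 2"
proof -
  have pos: "\<eta> \<bullet> \<eta> > 0" "\<kappa> \<bullet> \<kappa> > 0" using assms root_inner_pos simple_root by auto
  have neg: "\<eta> \<bullet> \<kappa> < 0" using simple_inner_nonpos[OF assms(1-3)] assms(4) by simp
  obtain m n :: int where mn: "\<eta> \<bullet> coroot \<kappa> = m" "\<kappa> \<bullet> coroot \<eta> = n"
    using cartan_int[of \<eta> \<kappa>] cartan_int[of \<kappa> \<eta>] simple_root assms by (metis Ints_cases)
  have m: "2 * (\<eta> \<bullet> \<kappa>) = m * (\<kappa> \<bullet> \<kappa>)" and n: "2 * (\<eta> \<bullet> \<kappa>) = n * (\<eta> \<bullet> \<eta>)"
    using mn pos by (auto simp: coroot_def field_simps inner_commute)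
  have "real_of_int m * (\<kappa> \<bullet> \<kappa>) < 0" "real_of_int n * (\<eta> \<bullet> \<eta>) < 0" using neg m n by linarith+
  then have "m \<le> -1" "n \<le> -1" using pos by (auto simp: mult_less_0_iff)
  then have "real_of_int m \<le> -1" "real_of_int n \<le> -1" by linarith+
  with pos have "2 * (\<eta> \<bullet> \<kappa>) \<le> - (\<kappa> \<bullet> \<kappa>)" "2 * (\<eta> \<bullet> \<kappa>) \<le> - (\<eta> \<bullet> \<eta>)"
    unfolding m[symmetric] n[symmetric]
    using mult_right_mono[of m "-1" "\<kappa> \<bullet> \<kappa>"] mult_right_mono[of n "-1" "\<eta> \<bullet> \<eta>"] m n by linarith+
  moreover have "2 * (norm \<eta> * norm \<kappa>) \<le> \<eta> \<bullet> \<eta> + \<kappa> \<bullet> \<kappa>"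
    using sum_squares_bound[of "norm \<eta>" "norm \<kappa>"] by (simp add: dot_square_norm)
  ultimately have "\<eta> \<bullet> \<kappa> \<le> - (norm \<eta> * norm \<kappa>) / 2" by linarith
  moreover have "norm \<eta> * norm \<kappa> > 0" using pos by simp
  ultimately have "(\<eta> \<bullet> \<kappa>) / (norm \<eta> * norm \<kappa>) \<le> - 1 / 2"
    by (simp add: divide_le_eq)
  moreover have "sgn \<eta> \<bullet> sgn \<kappa> = (\<eta> \<bullet> \<kappa>) / (norm \<eta> * norm \<kappa>)"
    by (simp add: sgn_div_norm divide_inverse)
  ultimately show ?thesis by simp
qed

lemma sgn_inner_nonpos:
  assumes "\<eta> \<in> \<Delta>" "\<kappa> \<in> \<Delta>" "\<eta> \<noteq> \<kappa>" shows "sgn \<eta> \<bullet> sgn \<kappa> \<le> 0"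
  using simple_inner_nonpos[OF assms] by (simp add: sgn_div_norm mult_nonneg_nonpos)

text \<open>The diagram is a forest: a cycle through \<open>\<alpha>\<close> would force the sum of the normalised simple
  roots over \<open>J \<union> {\<alpha>}\<close> to have norm \<open>0\<close>.\<close>

lemma unique_neighbour:
  assumes J: "J \<subseteq> \<Delta> - {\<alpha>}" "irreducible_roots J" and \<alpha>: "\<alpha> \<in> \<Delta>"
    and \<epsilon>: "\<epsilon> \<in> J" "\<epsilon>' \<in> J" "\<epsilon> \<bullet> \<alpha> \<noteq> 0" "\<epsilon>' \<bullet> \<alpha> \<noteq> 0"
  shows "\<epsilon> = \<epsilon>'"
proof (rule ccontr)
  assume ne: "\<epsilon> \<noteq> \<epsilon>'"
  have fin: "finite J" using J finite_simple finite_subset by blast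
  have unit: "sgn \<eta> \<bullet> sgn \<eta> = 1" if "\<eta> \<in> \<Delta>" for \<eta>
    using root_inner_pos[OF simple_root[OF that]] by (simp add: dot_square_norm norm_sgn)
  define s where "s S = (\<Sum>\<eta>\<in>S. sgn \<eta>)" for S :: "'a set"
  have insert: "s (insert b S) \<bullet> s (insert b S) = s S \<bullet> s S + 1 + 2 * (\<Sum>\<eta>\<in>S. sgn \<eta> \<bullet> sgn b)"
    if "finite S" "b \<notin> S" "b \<in> \<Delta>" for S b
  proof -
    have "s S \<bullet> sgn b = (\<Sum>\<eta>\<in>S. sgn \<eta> \<bullet> sgn b)" by (simp add: s_def inner_sum_left)
    moreover have "s (insert b S) = sgn b + s S" using that by (simp add: s_def)
    ultimately show ?thesis
      using unit[OF that(3)] by (simp add: inner_add_left inner_add_right inner_commute)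
  qed
  \<comment> \<open>Growth inside \<open>J\<close> from \<open>{\<epsilon>}\<close>: a new vertex
    adds 1 to the squared norm, and its link to the set takes away at least 1, so the bound 1
    survives up to \<open>S = J\<close>.\<close>
  define F where "F = {S. S \<subseteq> J \<and> S \<noteq> {} \<and> s S \<bullet> s S \<le> 1}"
  have "finite F" using fin by (auto simp: F_def)
  moreover have "{\<epsilon>} \<in> F" using \<epsilon>(1) J(1) unit[of \<epsilon>] by (auto simp: F_def s_def)
  ultimately obtain S where S: "S \<in> F" and max: "\<And>T. T \<in> F \<Longrightarrow> S \<subseteq> T \<Longrightarrow> S = T"
    using finite_has_maximal[of F] by blast
  have S': "S \<subseteq> J" "S \<noteq> {}" "s S \<bullet> s S \<le> 1" using S by (auto simp: F_def)
  have finS: "finite S" using S'(1) fin finite_subset by blast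
  have "S = J"
  proof (rule ccontr)
    assume "S \<noteq> J"
    then obtain a b where ab: "a \<in> S" "b \<in> J - S" "a \<bullet> b \<noteq> 0"
      using irreducible_roots_linkD[OF J(2) S'(1,2)] by metis
    have \<Delta>: "a \<in> \<Delta>" "b \<in> \<Delta>" "a \<noteq> b" "S \<subseteq> \<Delta>" using ab S'(1) J(1) by auto
    have "(\<Sum>\<eta>\<in>S. sgn \<eta> \<bullet> sgn b) \<le> (\<Sum>\<eta>\<in>{a}. sgn \<eta> \<bullet> sgn b)"
      using finS ab \<Delta> by (intro sum_le_partial_sum_nonpos sgn_inner_nonpos) auto
    also have "\<dots> \<le> - 1 / 2" using normalized_inner_le_half[OF \<Delta>(1,2,3) ab(3)] by simp
    finally have "s (insert b S) \<bullet> s (insert b S) \<le> 1"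
      using insert[OF finS _ \<Delta>(2)] ab(2) S'(3) by simp
    then have "insert b S \<in> F" using ab S'(1) by (auto simp: F_def)
    from max[OF this] ab(2) show False by blast
  qed
  have \<alpha>J: "\<alpha> \<notin> J" "\<epsilon> \<in> \<Delta>" "\<epsilon>' \<in> \<Delta>" "\<epsilon> \<noteq> \<alpha>" "\<epsilon>' \<noteq> \<alpha>" using J(1) \<epsilon>(1,2) by auto
  \<comment> \<open>The two links of \<open>\<alpha>\<close> take away at least 2 while its unit
    vector adds 1, which brings the bound down from 1 to 0.\<close>
  have "(\<Sum>\<eta>\<in>J. sgn \<eta> \<bullet> sgn \<alpha>) \<le> (\<Sum>\<eta>\<in>{\<epsilon>, \<epsilon>'}. sgn \<eta> \<bullet> sgn \<alpha>)"
    using fin \<epsilon> \<alpha> J(1) by (intro sum_le_partial_sum_nonpos sgn_inner_nonpos) auto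
  also have "\<dots> \<le> - 1"
    using ne normalized_inner_le_half[OF \<alpha>J(2) \<alpha> \<alpha>J(4) \<epsilon>(3)]
      normalized_inner_le_half[OF \<alpha>J(3) \<alpha> \<alpha>J(5) \<epsilon>(4)] by simp
  finally have "s (insert \<alpha> J) \<bullet> s (insert \<alpha> J) \<le> 0"
    using insert[OF fin \<alpha>J(1) \<alpha>] S'(3) \<open>S = J\<close> by simp
  then have "s (insert \<alpha> J) = 0" by (metis inner_gt_zero_iff not_le)
  moreover have "s (insert \<alpha> J) = (\<Sum>\<eta>\<in>insert \<alpha> J. inverse (norm \<eta>) *\<^sub>R \<eta>)"
    by (simp add: s_def sgn_div_norm)
  ultimately have "inverse (norm \<alpha>) = 0"
    using inner_sum_cw[of "insert \<alpha> J" \<alpha> "\<lambda>\<eta>. inverse (norm \<eta>)"] \<alpha> J(1) by auto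
  with root_inner_pos[OF simple_root[OF \<alpha>]] show False by simp
qed

text \<open>Only extremal vertices matter: if removing \<open>\<eta>\<close> separates \<open>\<eta>'\<close> from the affine vertex, then
  \<open>cw \<eta>' / m' - cw \<eta> / m\<close> agrees on \<open>span J\<close> with a vector \<open>z\<close> in the cone over the vertices
  separated from the affine vertex.\<close>

context
  fixes J :: "'a set"
  assumes J: "J \<subseteq> \<Delta>" "irreducible_roots J"
begin

abbreviation (input) "hr \<equiv> highest_root (\<Phi> \<inter> span J) J"
abbreviation (input) "ext_vertices \<equiv> extended_dynkin_vertices (\<Phi> \<inter> span J) J"

text \<open>The component of the affine vertex after deletion of \<open>\<eta>\<close>. Its size
  measures how close \<open>\<eta>\<close> is to being extremal.\<close>

definition affine_reach :: "'a \<Rightarrow> 'a set" where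
  "affine_reach \<eta> = {v. (- hr, v) \<in> (dynkin_edges (ext_vertices - {\<eta>}))\<^sup>*}"

text \<open>Ensures that deleting a simple root never deletes the affine vertex. If
  \<open>- hr\<close> were simple, \<open>hr\<close> would have coordinate -1 there, but all its
  coordinates on \<open>J\<close> are positive.\<close>

lemma minus_highest_not_simple: "- hr \<notin> J"
proof
  assume "- hr \<in> J"
  then show False
    using highest_root(4)[OF J, of "- hr"] inner_cw(2)[of "- hr" "- hr"] J(1) by auto
qed

lemma affine_reach_subset:
  assumes "\<eta> \<in> J" shows "affine_reach \<eta> \<subseteq> ext_vertices - {\<eta>}"
proof
  fix v assume "v \<in> affine_reach \<eta>"
  then have "(- hr, v) \<in> (dynkin_edges (ext_vertices - {\<eta>}))\<^sup>*" by (simp add: affine_reach_def)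
  then show "v \<in> ext_vertices - {\<eta>}"
    by (induction rule: rtrancl_induct)
      (use assms minus_highest_not_simple in \<open>auto simp: dynkin_edges_def extended_dynkin_vertices_def\<close>)
qed

lemma affine_reach_step:
  "v \<in> affine_reach \<eta> \<Longrightarrow> (v, \<kappa>) \<in> dynkin_edges (ext_vertices - {\<eta>}) \<Longrightarrow> \<kappa> \<in> affine_reach \<eta>"
  unfolding affine_reach_def mem_Collect_eq by (rule rtrancl.rtrancl_into_rtrancl)

lemma affine_reach_orthogonal:
  assumes "\<eta> \<in> J" "v \<in> affine_reach \<eta>" "\<kappa> \<in> J" "\<kappa> \<noteq> \<eta>" "\<kappa> \<notin> affine_reach \<eta>"
  shows "v \<bullet> \<kappa> = 0"
proof (rule ccontr)
  assume "v \<bullet> \<kappa> \<noteq> 0"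
  with assms affine_reach_subset[OF assms(1)] have "(v, \<kappa>) \<in> dynkin_edges (ext_vertices - {\<eta>})"
    by (auto simp: dynkin_edges_def extended_dynkin_vertices_def)
  with assms(2,5) affine_reach_step show False by blast
qed

lemma minus_highest_reached: "- hr \<in> affine_reach \<eta>"
  by (simp add: affine_reach_def)

lemma separated_coweight_le:
  assumes \<eta>: "\<eta> \<in> J" "\<eta>' \<in> J" "\<eta>' \<noteq> \<eta>" "\<eta>' \<notin> affine_reach \<eta>"
    and x: "x \<in> span J" "\<And>\<kappa>. \<kappa> \<in> J \<Longrightarrow> x \<bullet> \<kappa> \<ge> 0"
  shows "(x \<bullet> cw \<eta>) / (hr \<bullet> cw \<eta>) \<le> (x \<bullet> cw \<eta>') / (hr \<bullet> cw \<eta>')"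
proof -
  define K where "K = J - {\<eta>} - affine_reach \<eta>"
  have K: "K \<subseteq> J" "K \<subseteq> \<Delta>" "\<eta>' \<in> K" using \<eta> J(1) by (auto simp: K_def)
  have finJ: "finite J" using J(1) finite_simple finite_subset by blast
  have m: "hr \<bullet> cw \<kappa> > 0" if "\<kappa> \<in> J" for \<kappa> by (rule highest_root(4)[OF J that])
  have "independent K" using independent_mono[OF independent_simple K(2)] .
  \<comment> \<open>\<open>z\<close> is dual to \<open>\<eta>'\<close> up to scale within the
    separated set \<open>K\<close>. Reached vertices are orthogonal to \<open>K\<close>, hence to
    \<open>z\<close>, so within \<open>J\<close> only \<open>\<eta>\<close> and
    \<open>\<eta>'\<close> can have nonzero product with it.\<close>
  then obtain z where z: "z \<in> span K"
    and zK: "\<And>\<kappa>. \<kappa> \<in> K \<Longrightarrow> z \<bullet> \<kappa> = (if \<kappa> = \<eta>' then 1 / (hr \<bullet> cw \<eta>') else 0)"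
    by (rule span_vector_with_inner_products[where g = "\<lambda>\<kappa>. if \<kappa> = \<eta>' then 1 / (hr \<bullet> cw \<eta>') else 0"]) auto
  have reach: "z \<bullet> v = 0" if "v \<in> affine_reach \<eta>" for v
    using z span_base[of v "{v}"]
    by (rule orthogonal_spans[of K "{v}", rotated 1])
      (use affine_reach_orthogonal[OF \<eta>(1) that] in \<open>auto simp: K_def inner_commute\<close>)
  have z0: "z \<bullet> \<kappa> = 0" if "\<kappa> \<in> J" "\<kappa> \<noteq> \<eta>'" "\<kappa> \<noteq> \<eta>" for \<kappa>
    using zK[of \<kappa>] reach[of \<kappa>] that by (cases "\<kappa> \<in> K") (auto simp: K_def)
  have two: "z \<bullet> y = (y \<bullet> cw \<eta>') * (z \<bullet> \<eta>') + (y \<bullet> cw \<eta>) * (z \<bullet> \<eta>)" if "y \<in> span J" for y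
    unfolding inner_subset_expansion[OF J(1) that, of z]
    using finJ \<eta> z0 by (intro sum_two_terms) auto
  \<comment> \<open>The product with \<open>\<eta>\<close> was not prescribed: orthogonality to the
    affine vertex determines it.\<close>
  have "z \<bullet> hr = 0" using reach[OF minus_highest_reached] by simp
  then have "1 + (hr \<bullet> cw \<eta>) * (z \<bullet> \<eta>) = 0"
    using two[OF highest_root(2)[OF J]] zK[OF K(3)] m[OF \<eta>(2)] by simp
  then have "(hr \<bullet> cw \<eta>) * (z \<bullet> \<eta>) = - 1" by linarith
  then have z\<eta>: "z \<bullet> \<eta> = - (1 / (hr \<bullet> cw \<eta>))"
    using m[OF \<eta>(1)] by (simp add: field_simps)
  have "z \<bullet> cw \<kappa> \<ge> 0" if "\<kappa> \<in> K" for \<kappa>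
    by (rule dominant_imp_nonneg_coordinates[OF K(2) z]) (use zK K m[OF \<eta>(2)] that in auto)
  then have "x \<bullet> z \<ge> 0"
    unfolding inner_subset_expansion[OF K(2) z] using x(2) K(1) by (intro sum_nonneg mult_nonneg_nonneg) auto
  moreover have "z \<bullet> x = (x \<bullet> cw \<eta>') / (hr \<bullet> cw \<eta>') - (x \<bullet> cw \<eta>) / (hr \<bullet> cw \<eta>)"
    using two[OF x(1)] zK[OF K(3)] z\<eta> by simp
  ultimately show ?thesis by (simp add: inner_commute)
qed

text \<open>A path from the affine vertex avoiding \<open>\<eta>\<close> never meets
  \<open>\<eta>'\<close>, so it survives the deletion of \<open>\<eta>'\<close> instead. What is
  gained is \<open>\<eta>\<close> itself, which must be linked to a reached vertex.\<close>

lemma affine_reach_strict_mono: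
  assumes \<eta>: "\<eta> \<in> J" "\<eta>' \<in> J" "\<eta>' \<noteq> \<eta>" "\<eta>' \<notin> affine_reach \<eta>"
  shows "affine_reach \<eta> \<subset> affine_reach \<eta>'"
proof -
  have sub: "affine_reach \<eta> \<subseteq> affine_reach \<eta>'"
  proof
    fix v assume "v \<in> affine_reach \<eta>"
    then have "(- hr, v) \<in> (dynkin_edges (ext_vertices - {\<eta>}))\<^sup>*" by (simp add: affine_reach_def)
    then show "v \<in> affine_reach \<eta>'"
    proof (induction rule: rtrancl_induct)
      case base show ?case by (rule minus_highest_reached)
    next
      case (step y z)
      then have "y \<in> affine_reach \<eta>" by (simp add: affine_reach_def)
      moreover from this step(2) have "z \<in> affine_reach \<eta>" by (rule affine_reach_step)
      ultimately have "(y, z) \<in> dynkin_edges (ext_vertices - {\<eta>'})"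
        using step(2) \<eta>(4) by (auto simp: dynkin_edges_def)
      with step.IH show ?case by (rule affine_reach_step)
    qed
  qed
  have "\<exists>v\<in>affine_reach \<eta>. v \<bullet> \<eta> \<noteq> 0"
  proof (rule ccontr)
    assume no: "\<not> ?thesis"
    define D where "D = J - affine_reach \<eta>"
    have D: "\<eta> \<in> D" "D \<subseteq> J" "D \<subseteq> \<Delta>"
      using \<eta>(1) affine_reach_subset[OF \<eta>(1)] J(1) by (auto simp: D_def)
    \<comment> \<open>The part of \<open>hr\<close> carried by unreached vertices. If
      \<open>\<eta>\<close> had no link to a reached vertex, \<open>t\<close> would be orthogonal to
      all of them, including \<open>- hr\<close>, and
      \<open>t \<bullet> t = t \<bullet> hr = 0\<close> would contradict the positive
      \<open>\<eta>\<close>-coordinate.\<close>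
    define t where "t = (\<Sum>\<kappa>\<in>D. (hr \<bullet> cw \<kappa>) *\<^sub>R \<kappa>)"
    have orth: "v \<bullet> t = 0" if "v \<in> affine_reach \<eta>" for v
    proof -
      have "v \<bullet> \<kappa> = 0" if "\<kappa> \<in> D" for \<kappa>
        using no affine_reach_orthogonal[OF \<eta>(1) \<open>v \<in> affine_reach \<eta>\<close>, of \<kappa>] that \<open>v \<in> affine_reach \<eta>\<close>
        by (cases "\<kappa> = \<eta>") (auto simp: D_def)
      then show ?thesis by (simp add: t_def inner_sum_right)
    qed
    have "t \<bullet> hr = (\<Sum>\<kappa>\<in>J. (hr \<bullet> cw \<kappa>) * (t \<bullet> \<kappa>))"
      by (rule inner_subset_expansion[OF J(1) highest_root(2)[OF J]])
    also have "\<dots> = (\<Sum>\<kappa>\<in>D. (hr \<bullet> cw \<kappa>) * (t \<bullet> \<kappa>))"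
      using J(1) finite_simple finite_subset D(2) orth
      by (intro sum.mono_neutral_right) (auto simp: D_def inner_commute)
    also have "\<dots> = t \<bullet> (\<Sum>\<kappa>\<in>D. (hr \<bullet> cw \<kappa>) *\<^sub>R \<kappa>)"
      by (simp add: inner_sum_right)
    also have "\<dots> = t \<bullet> t" by (simp only: t_def)
    finally have "t = 0" using orth[OF minus_highest_reached] by (simp add: inner_commute)
    moreover have "t \<bullet> cw \<eta> = hr \<bullet> cw \<eta>"
      unfolding t_def using inner_sum_cw[of D \<eta> "\<lambda>\<kappa>. hr \<bullet> cw \<kappa>"] D by auto
    ultimately show False using highest_root(4)[OF J \<eta>(1)] by simp
  qed
  then obtain v where v: "v \<in> affine_reach \<eta>" "v \<bullet> \<eta> \<noteq> 0" by blast
  then have "(v, \<eta>) \<in> dynkin_edges (ext_vertices - {\<eta>'})"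
    using \<eta> affine_reach_subset[OF \<eta>(1)] by (auto simp: dynkin_edges_def extended_dynkin_vertices_def)
  with v(1) sub have "\<eta> \<in> affine_reach \<eta>'" using affine_reach_step by blast
  moreover have "\<eta> \<notin> affine_reach \<eta>" using affine_reach_subset[OF \<eta>(1)] by blast
  ultimately show ?thesis using sub by blast
qed

lemma extremal_rootI:
  assumes "\<eta> \<in> J" "ext_vertices - {\<eta>} \<subseteq> affine_reach \<eta>"
  shows "extremal_root (\<Phi> \<inter> span J) J \<eta>"
  unfolding extremal_root_def dynkin_connected_def
proof (intro conjI ballI)
  have reach: "(- hr, v) \<in> (dynkin_edges (ext_vertices - {\<eta>}))\<^sup>*" if "v \<in> ext_vertices - {\<eta>}" for v
    using assms(2) that by (auto simp: affine_reach_def)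
  show "ext_vertices - {\<eta>} \<noteq> {}"
    using minus_highest_reached affine_reach_subset[OF assms(1)] by blast
  fix x y assume "x \<in> ext_vertices - {\<eta>}" "y \<in> ext_vertices - {\<eta>}"
  then show "(x, y) \<in> (dynkin_edges (ext_vertices - {\<eta>}))\<^sup>*"
    using rtrancl_trans[OF dynkin_reach_sym[OF reach] reach] by blast
qed (rule assms(1))

text \<open>Among the vertices whose ratio is at least that of \<open>\<eta>\<close>, take one with
  the largest reach from the affine vertex. A vertex it fails to reach would have at least the same
  ratio and a strictly larger reach.\<close>

lemma extremal_dominates:
  assumes x: "x \<in> span J" "\<And>\<kappa>. \<kappa> \<in> J \<Longrightarrow> x \<bullet> \<kappa> \<ge> 0" and \<eta>: "\<eta> \<in> J"
  obtains \<kappa> where "extremal_root (\<Phi> \<inter> span J) J \<kappa>"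
    "(x \<bullet> cw \<eta>) / (hr \<bullet> cw \<eta>) \<le> (x \<bullet> cw \<kappa>) / (hr \<bullet> cw \<kappa>)"
proof -
  let ?v = "\<lambda>\<eta>. (x \<bullet> cw \<eta>) / (hr \<bullet> cw \<eta>)" let ?c = "\<lambda>\<eta>. card (affine_reach \<eta>)"
  have finV: "finite ext_vertices"
    using finite_subset[OF J(1) finite_simple] by (auto simp: extended_dynkin_vertices_def)
  define S where "S = {\<kappa>\<in>J. ?v \<eta> \<le> ?v \<kappa>}"
  have fin: "finite (?c ` S)" "?c ` S \<noteq> {}"
    using \<eta> finite_subset[OF J(1) finite_simple] by (auto simp: S_def)
  have "Max (?c ` S) \<in> ?c ` S" by (rule Max_in[OF fin])
  then obtain \<kappa> where \<kappa>: "Max (?c ` S) = ?c \<kappa>" "\<kappa> \<in> S" by (rule imageE)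
  have \<kappa>J: "\<kappa> \<in> J" "?v \<eta> \<le> ?v \<kappa>" using \<kappa>(2) by (auto simp: S_def)
  have "ext_vertices - {\<kappa>} \<subseteq> affine_reach \<kappa>"
  proof
    fix v assume v: "v \<in> ext_vertices - {\<kappa>}"
    show "v \<in> affine_reach \<kappa>"
    proof (rule ccontr)
      assume nv: "v \<notin> affine_reach \<kappa>"
      then have v': "v \<in> J" "v \<noteq> \<kappa>"
        using v minus_highest_reached by (auto simp: extended_dynkin_vertices_def)
      have "v \<in> S" using separated_coweight_le[OF \<kappa>J(1) v' nv x] \<kappa>J v' by (auto simp: S_def)
      then have "?c v \<le> ?c \<kappa>" using Max_ge[OF fin(1), of "?c v"] \<kappa>(1) by simp
      moreover have "finite (affine_reach v)"
        using affine_reach_subset[OF v'(1)] finV finite_subset by blast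
      from psubset_card_mono[OF this affine_reach_strict_mono[OF \<kappa>J(1) v' nv]]
      have "?c \<kappa> < ?c v" .
      ultimately show False by simp
    qed
  qed
  from that[OF extremal_rootI[OF \<kappa>J(1) this] \<kappa>J(2)] show ?thesis .
qed

end

end

section \<open>The minimal scaling factor\<close>

context simple_roots
begin

lemma parabolic_projection:
  shows "parabolic_projection \<Delta> \<alpha> x \<in> span (\<Delta> - {\<alpha>})"
    and "u \<in> span (\<Delta> - {\<alpha>}) \<Longrightarrow> parabolic_projection \<Delta> \<alpha> x \<bullet> u = x \<bullet> u"
  unfolding parabolic_projection_def by (rule orthogonal_projection_span, assumption?)+

lemma parabolic_projection_eqI:
  assumes "y \<in> span (\<Delta> - {\<alpha>})" "\<And>\<eta>. \<eta> \<in> \<Delta> - {\<alpha>} \<Longrightarrow> x \<bullet> \<eta> = y \<bullet> \<eta>"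
  shows "parabolic_projection \<Delta> \<alpha> x = y"
  by (rule inner_eq_on_spanning_set[OF parabolic_projection(1) assms(1)])
    (simp add: parabolic_projection(2) span_base assms(2))

lemma parabolic_projection_scale:
  "parabolic_projection \<Delta> \<alpha> (c *\<^sub>R x) = c *\<^sub>R parabolic_projection \<Delta> \<alpha> x"
  by (rule parabolic_projection_eqI)
    (simp_all add: parabolic_projection span_base span_scale)

text \<open>The factor is the one that cancels in
  \<open>\<alpha> \<bullet> coroot \<epsilon>\<close>, leaving
  \<open>\<alpha> \<bullet> \<epsilon>\<close> as the coefficient of
  \<open>cw \<epsilon>\<close>.\<close>

lemma fundamental_weight_eq:
  assumes "\<epsilon> \<in> \<Delta>" shows "fundamental_weight \<Delta> \<epsilon> = ((\<epsilon> \<bullet> \<epsilon>) / 2) *\<^sub>R cw \<epsilon>"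
  unfolding fundamental_weight_def
proof (rule the_equality)
  show w: "\<forall>\<eta>\<in>\<Delta>. (((\<epsilon> \<bullet> \<epsilon>) / 2) *\<^sub>R cw \<epsilon>) \<bullet> coroot \<eta> = (if \<eta> = \<epsilon> then 1 else 0)"
    using root_inner_pos[OF simple_root[OF assms]] by (auto simp: coroot_def inner_cw)
  fix v assume v: "\<forall>\<eta>\<in>\<Delta>. v \<bullet> coroot \<eta> = (if \<eta> = \<epsilon> then 1 else 0)"
  show "v = ((\<epsilon> \<bullet> \<epsilon>) / 2) *\<^sub>R cw \<epsilon>"
  proof (rule inner_eq_on_spanning_set[of _ \<Delta>])
    fix \<eta> assume \<eta>: "\<eta> \<in> \<Delta>"
    have "v \<bullet> coroot \<eta> = (((\<epsilon> \<bullet> \<epsilon>) / 2) *\<^sub>R cw \<epsilon>) \<bullet> coroot \<eta>"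
      using v w \<eta> by simp
    then show "v \<bullet> \<eta> = (((\<epsilon> \<bullet> \<epsilon>) / 2) *\<^sub>R cw \<epsilon>) \<bullet> \<eta>"
      using root_inner_pos[OF simple_root[OF \<eta>]] by (simp add: coroot_def)
  qed (simp_all add: span_simple)
qed

section \<open>Projections relative to the deleted simple root \<open>\<alpha>\<close>\<close>

context
  fixes \<alpha> :: 'a
  assumes \<alpha>: "\<alpha> \<in> \<Delta>"
begin

abbreviation (input) "I \<equiv> \<Delta> - {\<alpha>}"
abbreviation (input) "proj \<equiv> parabolic_projection \<Delta> \<alpha>"
abbreviation (input) "cpt \<equiv> simple_component I"
abbreviation (input) "comp_mark \<epsilon> \<eta> \<equiv> highest_root (\<Phi> \<inter> span (cpt \<epsilon>)) (cpt \<epsilon>) \<bullet> cw \<eta>"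

lemma comp_simple: "\<epsilon> \<in> I \<Longrightarrow> cpt \<epsilon> \<subseteq> \<Delta>"
  using simple_component_subset[of \<epsilon> I] by auto

lemma comp_highest_root:
  assumes "\<epsilon> \<in> I"
  defines "\<theta> \<equiv> highest_root (\<Phi> \<inter> span (cpt \<epsilon>)) (cpt \<epsilon>)"
  shows "\<theta> \<in> \<Phi>" "\<theta> \<in> span (cpt \<epsilon>)"
    and "\<beta> \<in> \<Phi> \<Longrightarrow> \<beta> \<in> span (cpt \<epsilon>) \<Longrightarrow> \<eta> \<in> cpt \<epsilon> \<Longrightarrow> \<beta> \<bullet> cw \<eta> \<le> \<theta> \<bullet> cw \<eta>"
    and "\<eta> \<in> cpt \<epsilon> \<Longrightarrow> \<theta> \<bullet> cw \<eta> > 0"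
proof -
  note h = highest_root[OF comp_simple[OF assms(1)] irreducible_simple_component[OF assms(1)],
    folded \<theta>_def]
  show "\<theta> \<in> \<Phi>" "\<theta> \<in> span (cpt \<epsilon>)" by (fact h(1), fact h(2))
  show "\<beta> \<in> \<Phi> \<Longrightarrow> \<beta> \<in> span (cpt \<epsilon>) \<Longrightarrow> \<eta> \<in> cpt \<epsilon> \<Longrightarrow> \<beta> \<bullet> cw \<eta> \<le> \<theta> \<bullet> cw \<eta>" by (fact h(3))
  show "\<eta> \<in> cpt \<epsilon> \<Longrightarrow> \<theta> \<bullet> cw \<eta> > 0" by (fact h(4))
qed

text \<open>The vector dual to \<open>\<epsilon>\<close> inside its component is orthogonal to the
  rest of \<open>I\<close>, so it has the products with \<open>I\<close> that characterise the
  projection. Its products with \<open>I\<close> are 0 or 1, so it is dominant and its coordinates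
  are nonnegative.\<close>

lemma projected_coweight:
  assumes "\<epsilon> \<in> I"
  shows "proj (cw \<epsilon>) \<in> span (cpt \<epsilon>)"
    and "\<kappa> \<in> I \<Longrightarrow> proj (cw \<epsilon>) \<bullet> \<kappa> = (if \<kappa> = \<epsilon> then 1 else 0)"
    and "\<eta> \<in> \<Delta> \<Longrightarrow> proj (cw \<epsilon>) \<bullet> cw \<eta> \<ge> 0"
proof -
  have val: "proj (cw \<epsilon>) \<bullet> \<kappa> = (if \<kappa> = \<epsilon> then 1 else 0)" if "\<kappa> \<in> I" for \<kappa>
    using parabolic_projection(2)[OF span_base[OF that]] that by (simp add: inner_cw)
  then show "\<kappa> \<in> I \<Longrightarrow> proj (cw \<epsilon>) \<bullet> \<kappa> = (if \<kappa> = \<epsilon> then 1 else 0)" .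
  have "independent (cpt \<epsilon>)" using independent_mono[OF independent_simple comp_simple[OF assms]] .
  then obtain q where q: "q \<in> span (cpt \<epsilon>)"
    "\<And>\<kappa>. \<kappa> \<in> cpt \<epsilon> \<Longrightarrow> q \<bullet> \<kappa> = (if \<kappa> = \<epsilon> then 1 else 0)"
    by (rule span_vector_with_inner_products[where g = "\<lambda>\<kappa>. if \<kappa> = \<epsilon> then 1 else 0"]) auto
  have qI: "q \<in> span I" using q(1) span_mono[OF simple_component_subset[OF assms]] by blast
  have "proj (cw \<epsilon>) = q"
  proof (rule inner_eq_on_spanning_set[OF parabolic_projection(1) qI])
    fix \<kappa> assume \<kappa>: "\<kappa> \<in> I"
    show "proj (cw \<epsilon>) \<bullet> \<kappa> = q \<bullet> \<kappa>"
    proof (cases "\<kappa> \<in> cpt \<epsilon>")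
      case False
      then have "q \<bullet> \<kappa> = 0" "\<kappa> \<noteq> \<epsilon>"
        using orthogonal_spans[OF simple_component_orthogonal[OF assms] q(1), where B = "I - cpt \<epsilon>" and y = \<kappa>] \<kappa>
          self_in_simple_component[of \<epsilon> I] by (auto intro: span_base)
      then show ?thesis using val[OF \<kappa>] by simp
    qed (use q(2) val[OF \<kappa>] in simp)
  qed
  then show "proj (cw \<epsilon>) \<in> span (cpt \<epsilon>)" using q(1) by simp
  show "proj (cw \<epsilon>) \<bullet> cw \<eta> \<ge> 0" if "\<eta> \<in> \<Delta>"
    by (rule dominant_imp_nonneg_coordinates[OF _ parabolic_projection(1) _ that]) (auto simp: val)
qed

text \<open>Clears the normalisation of the weight and shows that the maximum over extremal vertices
  is also the maximum over the whole component. The constant is used below only in this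
  form.\<close>

lemma component_constant_eq:
  assumes "\<epsilon> \<in> I"
  obtains \<eta> where "\<eta> \<in> cpt \<epsilon>"
    "- (\<alpha> \<bullet> coroot \<epsilon>) * component_constant \<Phi> \<Delta> \<alpha> \<epsilon>
      = - (\<alpha> \<bullet> \<epsilon>) * ((proj (cw \<epsilon>) \<bullet> cw \<eta>) / comp_mark \<epsilon> \<eta>)"
    "\<And>\<kappa>. \<kappa> \<in> cpt \<epsilon> \<Longrightarrow>
      (proj (cw \<epsilon>) \<bullet> cw \<kappa>) / comp_mark \<epsilon> \<kappa> \<le> (proj (cw \<epsilon>) \<bullet> cw \<eta>) / comp_mark \<epsilon> \<eta>"
proof -
  let ?J = "cpt \<epsilon>" let ?x = "proj (cw \<epsilon>)" let ?E = "extremal_simple_roots \<Phi> \<Delta> \<alpha> \<epsilon>"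
  let ?v = "\<lambda>\<eta>. (?x \<bullet> cw \<eta>) / comp_mark \<epsilon> \<eta>"
  have J: "?J \<subseteq> \<Delta>" "irreducible_roots ?J"
    by (rule comp_simple[OF assms], rule irreducible_simple_component[OF assms])
  have pos: "\<epsilon> \<bullet> \<epsilon> > 0" using root_inner_pos simple_root assms by blast
  have E: "?E = {\<eta>. extremal_root (\<Phi> \<inter> span ?J) ?J \<eta>}"
    unfolding extremal_simple_roots_def component_roots_eq[OF assms] component_simple_roots_eq[OF assms] ..
  then have EJ: "?E \<subseteq> ?J" by (auto simp: extremal_root_def)
  have finE: "finite ?E" using EJ J(1) finite_simple finite_subset by metis
  have dom: "\<exists>\<kappa>\<in>?E. ?v \<eta> \<le> ?v \<kappa>" if \<eta>: "\<eta> \<in> ?J" for \<eta>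
  proof -
    have nn: "?x \<bullet> \<kappa> \<ge> 0" if "\<kappa> \<in> ?J" for \<kappa>
      using projected_coweight(2)[OF assms subsetD[OF simple_component_subset[OF assms] that]]
      by (simp split: if_splits)
    obtain \<kappa> where "extremal_root (\<Phi> \<inter> span ?J) ?J \<kappa>" "?v \<eta> \<le> ?v \<kappa>"
      by (rule extremal_dominates[OF J projected_coweight(1)[OF assms] nn \<eta>])
    then show ?thesis unfolding E by blast
  qed
  \<comment> \<open>\<open>Max\<close> is informative only on a nonempty set; an extremal vertex
    exists because one dominates \<open>\<epsilon>\<close>.\<close>
  have neE: "?E \<noteq> {}" using dom[OF self_in_simple_component] by blast
  let ?f = "\<lambda>\<eta>. proj (fundamental_weight \<Delta> \<epsilon>) \<bullet> scaled_coweight \<Phi> \<Delta> \<alpha> \<epsilon> \<eta>"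
  have f: "?f \<eta> = (\<epsilon> \<bullet> \<epsilon>) / 2 * ?v \<eta>" if "\<eta> \<in> ?J" for \<eta>
  proof -
    have "mark \<Phi> \<Delta> \<alpha> \<epsilon> \<eta> = comp_mark \<epsilon> \<eta>"
      unfolding mark_def Let_def component_roots_eq[OF assms] component_simple_roots_eq[OF assms]
      using representation_subset_eq_inner_cw[OF J(1) highest_root(2)[OF J] that] .
    moreover have "proj (fundamental_weight \<Delta> \<epsilon>) = ((\<epsilon> \<bullet> \<epsilon>) / 2) *\<^sub>R ?x"
      using assms by (simp add: fundamental_weight_eq parabolic_projection_scale)
    ultimately show ?thesis by (simp add: scaled_coweight_def inverse_eq_divide)
  qed
  have "component_constant \<Phi> \<Delta> \<alpha> \<epsilon> \<in> ?f ` ?E"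
    unfolding component_constant_def using finE neE by (intro Max_in) auto
  then obtain \<eta> where \<eta>: "component_constant \<Phi> \<Delta> \<alpha> \<epsilon> = ?f \<eta>" "\<eta> \<in> ?E" by (rule imageE)
  have max: "?f \<kappa> \<le> ?f \<eta>" if "\<kappa> \<in> ?E" for \<kappa>
    unfolding \<eta>(1)[symmetric] component_constant_def using finE that by (intro Max_ge) auto
  have maxE: "?v \<kappa> \<le> ?v \<eta>" if "\<kappa> \<in> ?E" for \<kappa>
  proof -
    have "(\<epsilon> \<bullet> \<epsilon>) / 2 * ?v \<kappa> \<le> (\<epsilon> \<bullet> \<epsilon>) / 2 * ?v \<eta>"
      using max[OF that] unfolding f[OF subsetD[OF EJ that]] f[OF subsetD[OF EJ \<eta>(2)]] .
    then show ?thesis by (rule mult_left_le_imp_le) (use pos in simp)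
  qed
  show ?thesis
  proof (rule that)
    show "\<eta> \<in> ?J" using \<eta>(2) EJ by blast
    then have "component_constant \<Phi> \<Delta> \<alpha> \<epsilon> = (\<epsilon> \<bullet> \<epsilon>) / 2 * ?v \<eta>" unfolding \<eta>(1) by (rule f)
    then have "- (\<alpha> \<bullet> coroot \<epsilon>) * component_constant \<Phi> \<Delta> \<alpha> \<epsilon>
        = (- (\<alpha> \<bullet> coroot \<epsilon>) * ((\<epsilon> \<bullet> \<epsilon>) / 2)) * ?v \<eta>"
      by (simp only: mult.assoc)
    also have "- (\<alpha> \<bullet> coroot \<epsilon>) * ((\<epsilon> \<bullet> \<epsilon>) / 2) = - (\<alpha> \<bullet> \<epsilon>)" using pos by (simp add: coroot_def)
    finally show "- (\<alpha> \<bullet> coroot \<epsilon>) * component_constant \<Phi> \<Delta> \<alpha> \<epsilon> = - (\<alpha> \<bullet> \<epsilon>) * ?v \<eta>" .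
    fix \<kappa> assume "\<kappa> \<in> ?J"
    from dom[OF this] obtain \<delta> where "\<delta> \<in> ?E" "?v \<kappa> \<le> ?v \<delta>" by (rule bexE)
    from this(2) maxE[OF this(1)] show "?v \<kappa> \<le> ?v \<eta>" by (rule order_trans)
  qed
qed

lemma neighbour_in_I: "\<epsilon> \<in> neighbours \<Delta> \<alpha> \<Longrightarrow> \<epsilon> \<in> I"
  by (simp add: neighbours_def)

lemma neighbour_inner_neg: "\<epsilon> \<in> neighbours \<Delta> \<alpha> \<Longrightarrow> \<alpha> \<bullet> \<epsilon> < 0"
  using simple_inner_nonpos[of \<alpha> \<epsilon>] \<alpha> by (auto simp: neighbours_def inner_commute)

lemma finite_neighbours: "finite (neighbours \<Delta> \<alpha>)"
  using finite_simple by (simp add: neighbours_def)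

lemma projection_alpha: "proj \<alpha> = (\<Sum>\<epsilon>\<in>neighbours \<Delta> \<alpha>. (\<alpha> \<bullet> \<epsilon>) *\<^sub>R proj (cw \<epsilon>))"
proof (rule parabolic_projection_eqI)
  show "(\<Sum>\<epsilon>\<in>neighbours \<Delta> \<alpha>. (\<alpha> \<bullet> \<epsilon>) *\<^sub>R proj (cw \<epsilon>)) \<in> span I"
    by (intro span_sum span_scale parabolic_projection(1))
  fix \<eta> assume \<eta>: "\<eta> \<in> I"
  have "(\<Sum>\<epsilon>\<in>neighbours \<Delta> \<alpha>. (\<alpha> \<bullet> \<epsilon>) *\<^sub>R proj (cw \<epsilon>)) \<bullet> \<eta>
      = (\<Sum>\<epsilon>\<in>neighbours \<Delta> \<alpha>. if \<epsilon> = \<eta> then \<alpha> \<bullet> \<eta> else 0)"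
    unfolding inner_sum_left
    by (intro sum.cong) (use \<eta> projected_coweight(2)[OF neighbour_in_I \<eta>] in auto)
  also have "\<dots> = \<alpha> \<bullet> \<eta>"
    using \<eta> finite_neighbours by (auto simp: neighbours_def inner_commute)
  finally show "\<alpha> \<bullet> \<eta> = (\<Sum>\<epsilon>\<in>neighbours \<Delta> \<alpha>. (\<alpha> \<bullet> \<epsilon>) *\<^sub>R proj (cw \<epsilon>)) \<bullet> \<eta>" ..
qed

lemma neighbour_component_disjoint:
  assumes "\<epsilon> \<in> neighbours \<Delta> \<alpha>" "\<epsilon>' \<in> neighbours \<Delta> \<alpha>" "\<eta> \<in> cpt \<epsilon>" "\<eta> \<in> cpt \<epsilon>'"
  shows "\<epsilon> = \<epsilon>'"
proof (rule unique_neighbour)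
  show "cpt \<epsilon> \<subseteq> I" "irreducible_roots (cpt \<epsilon>)"
    using neighbour_in_I[OF assms(1)]
    by (rule simple_component_subset, rule irreducible_simple_component)
  show "\<epsilon>' \<in> cpt \<epsilon>" using assms(3,4) by (rule simple_component_disjoint)
  show "\<epsilon> \<bullet> \<alpha> \<noteq> 0" "\<epsilon>' \<bullet> \<alpha> \<noteq> 0" using assms(1,2) by (auto simp: neighbours_def)
qed (rule \<alpha>, rule self_in_simple_component)

lemma coweight_vanishes:
  assumes "\<epsilon> \<in> I" "x \<in> span (cpt \<epsilon>)" "\<eta> \<in> \<Delta>" "\<eta> \<notin> cpt \<epsilon>" shows "x \<bullet> cw \<eta> = 0"
  using mem_span_subset_iff[OF comp_simple[OF assms(1)]] assms by blast

text \<open>Coordinatewise, \<open>\<beta> \<ge> \<alpha>\<close> for \<open>\<beta>\<close> with \<open>\<alpha>\<close>-coordinate \<open>1\<close>; so a functional that is dominant on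
  \<open>\<Phi>\<^sub>\<alpha>\<close> is minimal at \<open>\<alpha>\<close>. Reflecting in a simple root negative on \<open>g\<close> makes one positive root fewer
  negative.\<close>

lemma dominant_functional_below:
  fixes g :: 'a
  assumes "\<beta> \<in> \<Phi>" "\<beta> \<bullet> cw \<alpha> = 1" "\<And>\<gamma>. \<gamma> \<in> \<Phi> \<Longrightarrow> \<gamma> \<in> span I \<Longrightarrow> P (g \<bullet> \<gamma>)"
    and "g \<in> span I"
  obtains h where "h \<in> span I" "\<And>\<eta>. \<eta> \<in> I \<Longrightarrow> h \<bullet> \<eta> \<ge> 0" "h \<bullet> \<alpha> \<le> g \<bullet> \<beta>"
    "\<And>\<gamma>. \<gamma> \<in> \<Phi> \<Longrightarrow> \<gamma> \<in> span I \<Longrightarrow> P (h \<bullet> \<gamma>)"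
  using assms
proof (induction "card {\<gamma>\<in>positive_roots. g \<bullet> \<gamma> < 0}" arbitrary: g \<beta> thesis rule: less_induct)
  case less
  show ?case
  proof (cases "\<forall>\<eta>\<in>I. g \<bullet> \<eta> \<ge> 0")
    case True
    have nn: "\<beta> \<bullet> cw \<kappa> \<ge> 0" if "\<kappa> \<in> \<Delta>" for \<kappa>
      using root_signs_pos[OF less.prems(2) \<alpha> _ that] less.prems(3) by simp
    have "\<beta> - \<alpha> \<in> span I"
      using less.prems(3) \<alpha> by (subst mem_span_subset_iff) (auto simp: inner_diff_left inner_cw)
    then have "g \<bullet> (\<beta> - \<alpha>) = (\<Sum>\<kappa>\<in>I. ((\<beta> - \<alpha>) \<bullet> cw \<kappa>) * (g \<bullet> \<kappa>))"
      by (intro inner_subset_expansion) auto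
    also have "\<dots> \<ge> 0"
      using True nn \<alpha> by (intro sum_nonneg mult_nonneg_nonneg) (auto simp: inner_diff_left inner_cw)
    finally have "g \<bullet> \<alpha> \<le> g \<bullet> \<beta>" by (simp add: inner_diff_right)
    with True less.prems(1,4,5) show ?thesis by blast
  next
    case False
    then obtain \<eta> where \<eta>: "\<eta> \<in> I" "g \<bullet> \<eta> < 0" by force
    then have \<eta>': "\<eta> \<in> \<Delta>" "\<eta> \<in> \<Phi>" "\<eta> \<noteq> \<alpha>" using simple_root by auto
    let ?s = "root_reflection \<eta>"
    let ?N = "\<lambda>g. {\<gamma>\<in>positive_roots. g \<bullet> \<gamma> < 0}"
    have \<eta>pos: "\<eta> \<in> positive_roots" using \<eta>' by (auto simp: positive_roots_def inner_cw)
    have fin: "finite (?N g)" using finite_roots by (auto simp: positive_roots_def)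
    \<comment> \<open>\<open>?s\<close> permutes the positive roots other than
      \<open>\<eta>\<close>. As \<open>g\<close> is negative at \<open>\<eta>\<close>,
      \<open>?s g\<close> is positive there, so \<open>\<eta>\<close> leaves the count and nothing
      replaces it.\<close>
    have sub: "?s ` ?N (?s g) \<subseteq> ?N g - {\<eta>}"
    proof
      fix \<delta> assume "\<delta> \<in> ?s ` ?N (?s g)"
      then obtain \<gamma> where \<gamma>: "\<gamma> \<in> positive_roots" "?s g \<bullet> \<gamma> < 0" "\<delta> = ?s \<gamma>" by blast
      then have neg: "g \<bullet> \<delta> < 0" by (simp add: root_reflection_inner_commute)
      have "\<gamma> \<noteq> \<eta>" using neg \<gamma>(3) \<eta>(2) by (auto simp: root_reflection_self)
      then have "\<delta> \<in> positive_roots" using simple_reflection_positive \<gamma>(1,3) \<eta>'(1) by blast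
      moreover have "\<delta> \<noteq> \<eta>"
      proof
        assume "\<delta> = \<eta>"
        then have "\<gamma> = - \<eta>" using \<gamma>(3) root_reflection_involution[of \<eta> \<gamma>] root_reflection_self by metis
        then show False using \<gamma>(1) \<eta>'(1) inner_cw(2)[OF \<eta>'(1), of \<eta>] by (auto simp: positive_roots_def)
      qed
      ultimately show "\<delta> \<in> ?N g - {\<eta>}" using neg by blast
    qed
    have "inj_on ?s (?N (?s g))" by (metis inj_on_inverseI root_reflection_involution)
    then have "card (?N (?s g)) \<le> card (?N g - {\<eta>})"
      using card_mono[OF _ sub] fin by (simp add: card_image)
    also have "\<dots> < card (?N g)" using fin \<eta>pos \<eta>(2) by (intro card_Diff1_less) auto
    finally have less': "card (?N (?s g)) < card (?N g)" .
    obtain h where h: "h \<in> span I" "\<And>\<eta>. \<eta> \<in> I \<Longrightarrow> h \<bullet> \<eta> \<ge> 0" "h \<bullet> \<alpha> \<le> ?s g \<bullet> ?s \<beta>"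
      "\<And>\<gamma>. \<gamma> \<in> \<Phi> \<Longrightarrow> \<gamma> \<in> span I \<Longrightarrow> P (h \<bullet> \<gamma>)"
    proof (rule less.hyps[OF less'])
      show "?s \<beta> \<in> \<Phi>" using reflection_root \<eta>'(2) less.prems(2) by blast
      show "?s \<beta> \<bullet> cw \<alpha> = 1" using less.prems(3) \<eta>' by (simp add: inner_root_reflection inner_cw)
      show "?s g \<in> span I" using root_reflection_span[OF span_base[OF \<eta>(1)] less.prems(5)] .
      \<comment> \<open>\<open>P\<close> stands for the constraint imposed by the polytope. It is
        required at all roots of \<open>span I\<close> at once, and \<open>?s\<close> permutes
        these, so it passes to the reflected functional.\<close>
      fix \<gamma> assume "\<gamma> \<in> \<Phi>" "\<gamma> \<in> span I"
      then have "?s \<gamma> \<in> \<Phi>" "?s \<gamma> \<in> span I"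
        using reflection_root \<eta>'(2) root_reflection_span[OF span_base[OF \<eta>(1)]] by blast+
      then show "P (?s g \<bullet> \<gamma>)" using less.prems(4) by (simp add: root_reflection_inner_commute)
    qed blast
    have "?s g \<bullet> ?s \<beta> = g \<bullet> \<beta>"
      by (simp add: root_reflection_inner_commute root_reflection_involution)
    with h less.prems(1) show ?thesis by metis
  qed
qed

lemma parabolic_subsystem_eq: "parabolic_subsystem \<Phi> \<Delta> \<alpha> = \<Phi> \<inter> span I"
  unfolding parabolic_subsystem_def by (rule root_subsystem_hull) blast

section \<open>Upper and lower bounds for the scaling factor\<close>

abbreviation (input) "bound \<equiv>
  \<Sum>\<epsilon>\<in>neighbours \<Delta> \<alpha>. - (\<alpha> \<bullet> coroot \<epsilon>) * component_constant \<Phi> \<Delta> \<alpha> \<epsilon>"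

lemma bound_term_nonneg:
  assumes "\<epsilon> \<in> neighbours \<Delta> \<alpha>"
  shows "- (\<alpha> \<bullet> coroot \<epsilon>) * component_constant \<Phi> \<Delta> \<alpha> \<epsilon> \<ge> 0"
proof -
  note I = neighbour_in_I[OF assms]
  obtain \<eta> where \<eta>: "\<eta> \<in> cpt \<epsilon>" "- (\<alpha> \<bullet> coroot \<epsilon>) * component_constant \<Phi> \<Delta> \<alpha> \<epsilon>
      = - (\<alpha> \<bullet> \<epsilon>) * ((proj (cw \<epsilon>) \<bullet> cw \<eta>) / comp_mark \<epsilon> \<eta>)"
    by (rule component_constant_eq[OF I]) blast
  have "(proj (cw \<epsilon>) \<bullet> cw \<eta>) / comp_mark \<epsilon> \<eta> \<ge> 0"
    using projected_coweight(3)[OF I, of \<eta>] comp_highest_root(4)[OF I \<eta>(1)] comp_simple[OF I] \<eta>(1)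
    by (intro divide_nonneg_pos) auto
  then show ?thesis
    unfolding \<eta>(2) using neighbour_inner_neg[OF assms] by (intro mult_nonneg_nonneg) auto
qed

lemma bound_nonneg: "bound \<ge> 0"
  by (intro sum_nonneg bound_term_nonneg)

text \<open>For the dominant functional \<open>h\<close> obtained from a separating one, each
  summand of \<open>- proj \<alpha>\<close> is controlled by the maximum \<open>t\<close> of
  \<open>h\<close> on the roots. This gives \<open>h \<bullet> \<alpha> \<ge> - (M * t) > b\<close>,
  against \<open>h \<bullet> \<alpha> \<le> g \<bullet> \<beta> < b\<close>.\<close>

lemma projected_root_in_scaled_polytope:
  assumes \<beta>: "\<beta> \<in> \<Phi>" "\<beta> \<bullet> cw \<alpha> = 1"
  shows "proj \<beta> \<in> (*\<^sub>R) bound ` root_polytope (\<Phi> \<inter> span I)"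
proof (cases "\<Phi> \<inter> span I = {}")
  \<comment> \<open>Here \<open>\<Delta> = {\<alpha>}\<close>: the projection is 0, and the polytope
    is \<open>{0}\<close> by convention.\<close>
  case True
  then have "I = {}" using simple_subset by (auto intro: span_base)
  then have "span I = {0}" by (simp only: span_empty)
  with parabolic_projection(1)[of \<alpha> \<beta>] have "proj \<beta> = 0" by simp
  with True show ?thesis by (simp add: root_polytope_def)
next
  case False
  let ?\<Psi> = "\<Phi> \<inter> span I"
  define M where "M = bound"
  let ?S = "(*\<^sub>R) M ` (convex hull ?\<Psi>)"
  have fin: "finite ?\<Psi>" using finite_roots by blast
  have "proj \<beta> \<in> ?S"
  proof (rule ccontr)
    assume "proj \<beta> \<notin> ?S"
    moreover have "convex ?S" by (intro convex_scaling convex_convex_hull)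
    moreover have "closed ?S"
      by (rule compact_imp_closed[OF compact_scaling[OF compact_convex_hull[OF finite_imp_compact[OF fin]]]])
    ultimately have "\<exists>a b. a \<bullet> proj \<beta> < b \<and> (\<forall>z\<in>?S. b < a \<bullet> z)"
      by (intro separating_hyperplane_closed_point)
    then obtain a b where ab: "a \<bullet> proj \<beta> < b" "\<And>z. z \<in> ?S \<Longrightarrow> b < a \<bullet> z"
      by (elim exE conjE) (rule that, auto)
    \<comment> \<open>Only vectors of \<open>span I\<close> are tested, so \<open>a\<close> may be
      replaced by its projection; after that \<open>\<beta>\<close> may stand in for
      \<open>proj \<beta>\<close>, and reflections act on both arguments.\<close>
    define g where "g = proj a"
    have g: "g \<bullet> x = a \<bullet> x" if "x \<in> span I" for x
      unfolding g_def using parabolic_projection(2)[OF that] .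
    have gI: "g \<in> span I" unfolding g_def by (rule parabolic_projection(1))
    have g\<beta>: "g \<bullet> \<beta> = a \<bullet> proj \<beta>"
      using g[OF parabolic_projection(1)] parabolic_projection(2)[OF gI, of \<beta>] by (simp add: inner_commute)
    have g\<Psi>: "b < M * (g \<bullet> \<gamma>)" if "\<gamma> \<in> \<Phi>" "\<gamma> \<in> span I" for \<gamma>
    proof -
      have "M *\<^sub>R \<gamma> \<in> ?S" using that by (intro imageI hull_inc) blast
      from ab(2)[OF this] show ?thesis by (simp add: g[OF that(2)])
    qed
    obtain h where hI: "h \<in> span I" and h: "\<And>\<eta>. \<eta> \<in> I \<Longrightarrow> h \<bullet> \<eta> \<ge> 0" "h \<bullet> \<alpha> \<le> g \<bullet> \<beta>"
      "\<And>\<gamma>. \<gamma> \<in> \<Phi> \<Longrightarrow> \<gamma> \<in> span I \<Longrightarrow> b < M * (h \<bullet> \<gamma>)"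
      by (rule dominant_functional_below[where P = "\<lambda>t. b < M * t", OF \<beta> g\<Psi> gI]) blast+
    have "Max ((\<bullet>) h ` ?\<Psi>) \<in> (\<bullet>) h ` ?\<Psi>" using fin False by (intro Max_in) auto
    then obtain \<gamma> where \<gamma>: "Max ((\<bullet>) h ` ?\<Psi>) = h \<bullet> \<gamma>" "\<gamma> \<in> ?\<Psi>" by (rule imageE)
    define t where "t = h \<bullet> \<gamma>"
    have t: "h \<bullet> \<delta> \<le> t" if "\<delta> \<in> ?\<Psi>" for \<delta>
      unfolding t_def \<gamma>(1)[symmetric] using fin that by simp
    \<comment> \<open>The root set is closed under negation, so the lower bound \<open>b\<close> at
      \<open>- \<gamma>\<close> becomes an upper bound for \<open>M * t\<close>.\<close>
    have "b < M * (h \<bullet> - \<gamma>)" using h(3)[of "- \<gamma>"] \<gamma>(2) minus_root span_neg by blast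
    then have bt: "M * t < - b" by (simp add: t_def)
    have summand: "- (h \<bullet> ((\<alpha> \<bullet> \<epsilon>) *\<^sub>R proj (cw \<epsilon>)))
        \<le> (- (\<alpha> \<bullet> coroot \<epsilon>) * component_constant \<Phi> \<Delta> \<alpha> \<epsilon>) * t" if \<epsilon>: "\<epsilon> \<in> neighbours \<Delta> \<alpha>" for \<epsilon>
    proof -
      note I = neighbour_in_I[OF \<epsilon>]
      note J = comp_simple[OF I] irreducible_simple_component[OF I]
      let ?x = "proj (cw \<epsilon>)"
      let ?\<theta> = "highest_root (\<Phi> \<inter> span (cpt \<epsilon>)) (cpt \<epsilon>)"
      obtain \<eta> where \<eta>: "\<eta> \<in> cpt \<epsilon>" "- (\<alpha> \<bullet> coroot \<epsilon>) * component_constant \<Phi> \<Delta> \<alpha> \<epsilon>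
          = - (\<alpha> \<bullet> \<epsilon>) * ((?x \<bullet> cw \<eta>) / comp_mark \<epsilon> \<eta>)"
        "\<And>\<kappa>. \<kappa> \<in> cpt \<epsilon> \<Longrightarrow> (?x \<bullet> cw \<kappa>) / comp_mark \<epsilon> \<kappa> \<le> (?x \<bullet> cw \<eta>) / comp_mark \<epsilon> \<eta>"
        by (rule component_constant_eq[OF I]) blast
      define c where "c = (?x \<bullet> cw \<eta>) / comp_mark \<epsilon> \<eta>"
      have c: "c \<ge> 0"
        unfolding c_def using projected_coweight(3)[OF I, of \<eta>] comp_highest_root(4)[OF I \<eta>(1)] J(1) \<eta>(1)
        by (intro divide_nonneg_pos) auto
      have "h \<bullet> ?x = (\<Sum>\<kappa>\<in>cpt \<epsilon>. (?x \<bullet> cw \<kappa>) * (h \<bullet> \<kappa>))"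
        by (rule inner_subset_expansion[OF J(1) projected_coweight(1)[OF I]])
      \<comment> \<open>Coordinatewise \<open>?x\<close> is at most \<open>c\<close> times the
        highest root, \<open>c\<close> being the largest ratio in the component; \<open>h\<close> is
        nonnegative on \<open>I\<close> and preserves this.\<close>
      also have "\<dots> \<le> (\<Sum>\<kappa>\<in>cpt \<epsilon>. (c * comp_mark \<epsilon> \<kappa>) * (h \<bullet> \<kappa>))"
      proof (intro sum_mono mult_right_mono)
        fix \<kappa> assume \<kappa>: "\<kappa> \<in> cpt \<epsilon>"
        then show "h \<bullet> \<kappa> \<ge> 0" using h(1) simple_component_subset[OF I] by blast
        show "?x \<bullet> cw \<kappa> \<le> c * comp_mark \<epsilon> \<kappa>"
          using \<eta>(3)[OF \<kappa>] comp_highest_root(4)[OF I \<kappa>] by (simp add: c_def[symmetric] pos_divide_le_eq)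
      qed
      also have "\<dots> = c * (h \<bullet> ?\<theta>)"
        unfolding inner_subset_expansion[OF J(1) comp_highest_root(2)[OF I], of h]
        by (simp add: sum_distrib_left mult.assoc)
      also have "\<dots> \<le> c * t"
        using c t comp_highest_root(1,2)[OF I] span_mono[OF simple_component_subset[OF I]]
        by (intro mult_left_mono) auto
      finally have "- (\<alpha> \<bullet> \<epsilon>) * (h \<bullet> ?x) \<le> - (\<alpha> \<bullet> \<epsilon>) * (c * t)"
        using neighbour_inner_neg[OF \<epsilon>] by (intro mult_left_mono) auto
      then show ?thesis unfolding \<eta>(2) c_def[symmetric] by (simp add: mult.assoc)
    qed
    have "- (h \<bullet> proj \<alpha>) = (\<Sum>\<epsilon>\<in>neighbours \<Delta> \<alpha>. - (h \<bullet> ((\<alpha> \<bullet> \<epsilon>) *\<^sub>R proj (cw \<epsilon>))))"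
      unfolding projection_alpha inner_sum_right sum_negf ..
    also have "\<dots> \<le> M * t"
      unfolding M_def sum_distrib_right by (intro sum_mono summand)
    finally have "b < h \<bullet> proj \<alpha>" using bt by linarith
    also have "h \<bullet> proj \<alpha> = h \<bullet> \<alpha>" using parabolic_projection(2)[OF hI] by (simp add: inner_commute)
    finally show False using h(2) g\<beta> ab(1) by simp
  qed
  with False show ?thesis by (simp add: root_polytope_def M_def)
qed

text \<open>The functional \<open>f\<close> is a certificate of optimality: it is at least -1 on the
  polytope and equals \<open>- bound\<close> at \<open>proj \<alpha>\<close>, where it is also
  \<open>r\<close> times a value on the polytope.\<close>

lemma bound_le_of_mem_scaled_polytope:
  assumes r: "0 \<le> r" "proj \<alpha> \<in> (*\<^sub>R) r ` root_polytope (\<Phi> \<inter> span I)"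
  shows "bound \<le> r"
proof -
  let ?N = "neighbours \<Delta> \<alpha>" let ?x = "\<lambda>\<epsilon>. proj (cw \<epsilon>)"
  have "\<forall>\<epsilon>\<in>?N. \<exists>\<eta>. \<eta> \<in> cpt \<epsilon> \<and> - (\<alpha> \<bullet> coroot \<epsilon>) * component_constant \<Phi> \<Delta> \<alpha> \<epsilon>
      = - (\<alpha> \<bullet> \<epsilon>) * ((?x \<epsilon> \<bullet> cw \<eta>) / comp_mark \<epsilon> \<eta>)"
  proof
    fix \<epsilon> assume "\<epsilon> \<in> ?N"
    from component_constant_eq[OF neighbour_in_I[OF this]]
    show "\<exists>\<eta>. \<eta> \<in> cpt \<epsilon> \<and> - (\<alpha> \<bullet> coroot \<epsilon>) * component_constant \<Phi> \<Delta> \<alpha> \<epsilon>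
      = - (\<alpha> \<bullet> \<epsilon>) * ((?x \<epsilon> \<bullet> cw \<eta>) / comp_mark \<epsilon> \<eta>)" by blast
  qed
  then obtain e where e: "\<And>\<epsilon>. \<epsilon> \<in> ?N \<Longrightarrow> e \<epsilon> \<in> cpt \<epsilon>"
    and c: "\<And>\<epsilon>. \<epsilon> \<in> ?N \<Longrightarrow> - (\<alpha> \<bullet> coroot \<epsilon>) * component_constant \<Phi> \<Delta> \<alpha> \<epsilon>
      = - (\<alpha> \<bullet> \<epsilon>) * ((?x \<epsilon> \<bullet> cw (e \<epsilon>)) / comp_mark \<epsilon> (e \<epsilon>))"
    by (auto dest!: bchoice)
  have e\<Delta>: "e \<epsilon> \<in> \<Delta>" if "\<epsilon> \<in> ?N" for \<epsilon>
    using e[OF that] comp_simple[OF neighbour_in_I[OF that]] by blast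
  have e_other: "e \<epsilon>' \<notin> cpt \<epsilon>" if "\<epsilon> \<in> ?N" "\<epsilon>' \<in> ?N" "\<epsilon>' \<noteq> \<epsilon>" for \<epsilon> \<epsilon>'
    using neighbour_component_disjoint[OF that(1,2) _ e[OF that(2)]] that(3) by blast
  \<comment> \<open>One scaled coweight for each neighbour. The chosen vertices lie in different
    components, so a vector in the span of one component pairs only with its own summand.\<close>
  define f where "f = (\<Sum>\<epsilon>\<in>?N. (1 / comp_mark \<epsilon> (e \<epsilon>)) *\<^sub>R cw (e \<epsilon>))"
  have f_span: "x \<bullet> f = (x \<bullet> cw (e \<epsilon>)) / comp_mark \<epsilon> (e \<epsilon>)"
    if \<epsilon>: "\<epsilon> \<in> ?N" and x: "x \<in> span (cpt \<epsilon>)" for x \<epsilon>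
  proof -
    have "x \<bullet> f = (\<Sum>\<epsilon>'\<in>?N. (x \<bullet> cw (e \<epsilon>')) / comp_mark \<epsilon>' (e \<epsilon>'))"
      by (simp add: f_def inner_sum_right)
    also have "\<dots> = (\<Sum>\<epsilon>'\<in>{\<epsilon>}. (x \<bullet> cw (e \<epsilon>')) / comp_mark \<epsilon>' (e \<epsilon>'))"
      using finite_neighbours \<epsilon> coweight_vanishes[OF neighbour_in_I[OF \<epsilon>] x e\<Delta> e_other[OF \<epsilon>]]
      by (intro sum.mono_neutral_right) auto
    finally show ?thesis by simp
  qed
  have root_le: "\<beta> \<bullet> f \<le> 1" if \<beta>: "\<beta> \<in> \<Phi>" "\<beta> \<in> span I" for \<beta>
  proof (cases "\<exists>\<epsilon>\<in>?N. \<beta> \<bullet> cw (e \<epsilon>) \<noteq> 0")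
    case True
    then obtain \<epsilon> where \<epsilon>: "\<epsilon> \<in> ?N" "\<beta> \<bullet> cw (e \<epsilon>) \<noteq> 0" by blast
    note I = neighbour_in_I[OF \<epsilon>(1)]
    \<comment> \<open>A nonzero coordinate at \<open>e \<epsilon>\<close> excludes the orthogonal
      rest, so \<open>\<beta>\<close> belongs to the component of \<open>\<epsilon>\<close>, where
      the mark bounds that coordinate.\<close>
    have "\<beta> \<notin> span (I - cpt \<epsilon>)"
      using mem_span_subset_iff[of "I - cpt \<epsilon>" \<beta>] e[OF \<epsilon>(1)] e\<Delta>[OF \<epsilon>(1)] \<epsilon>(2) by auto
    then have "\<beta> \<in> span (cpt \<epsilon>)"
      using root_in_orthogonal_part[OF _ simple_component_subset[OF I] simple_component_orthogonal[OF I] \<beta>]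
      by blast
    then show ?thesis
      using f_span[OF \<epsilon>(1)] comp_highest_root(3)[OF I \<beta>(1) _ e[OF \<epsilon>(1)]]
        comp_highest_root(4)[OF I e[OF \<epsilon>(1)]] by (simp add: divide_le_eq)
  next
    case False
    then have "\<beta> \<bullet> f = 0" by (simp add: f_def inner_sum_right)
    then show ?thesis by simp
  qed
  \<comment> \<open>\<open>root_le\<close> at the opposite root gives the lower bound on roots; a
    halfspace is convex, so the bound extends to the hull.\<close>
  have "root_polytope (\<Phi> \<inter> span I) \<subseteq> {x. f \<bullet> x \<ge> - 1}"
  proof (cases "\<Phi> \<inter> span I = {}")
    case False
    have "\<Phi> \<inter> span I \<subseteq> {x. f \<bullet> x \<ge> - 1}"
      using root_le[of "- x" for x] minus_root span_neg by (force simp: inner_commute)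
    then show ?thesis
      unfolding root_polytope_def using False by (simp add: subset_hull convex_halfspace_ge)
  qed (simp add: root_polytope_def)
  then obtain z where z: "proj \<alpha> = r *\<^sub>R z" "f \<bullet> z \<ge> - 1" using r(2) by blast
  have "- bound = (\<Sum>\<epsilon>\<in>?N. (\<alpha> \<bullet> \<epsilon>) * (?x \<epsilon> \<bullet> f))"
    using c f_span projected_coweight(1)[OF neighbour_in_I]
    by (simp add: sum_negf[symmetric] del: sum_negf)
  also have "\<dots> = proj \<alpha> \<bullet> f" by (simp add: projection_alpha inner_sum_left)
  also have "\<dots> = r * (f \<bullet> z)" using z(1) by (simp add: inner_commute)
  also have "\<dots> \<ge> - r" using mult_left_mono[OF z(2) r(1)] by simp
  finally show ?thesis by simp
qed

lemma coordinate_one_roots_eq: "coordinate_one_roots \<Phi> \<Delta> \<alpha> = {\<beta>\<in>\<Phi>. \<beta> \<bullet> cw \<alpha> = 1}"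
  using \<alpha> by (simp add: coordinate_one_roots_def representation_eq_inner_cw)

text \<open>\<open>\<alpha>\<close> is itself a root of \<open>\<alpha>\<close>-coordinate 1, so the
  first set of scalings lies in the second. Membership of \<open>bound\<close> in the first and the
  lower bound on the second settle both minima.\<close>

lemma minimal_scalings:
  shows "is_minimum {r. 0 \<le> r \<and> proj ` coordinate_one_roots \<Phi> \<Delta> \<alpha>
      \<subseteq> (*\<^sub>R) r ` root_polytope (parabolic_subsystem \<Phi> \<Delta> \<alpha>)} bound"
    and "is_minimum {r. 0 \<le> r \<and> proj \<alpha> \<in> (*\<^sub>R) r ` root_polytope (parabolic_subsystem \<Phi> \<Delta> \<alpha>)} bound"
proof -
  have mem: "proj \<beta> \<in> (*\<^sub>R) bound ` root_polytope (\<Phi> \<inter> span I)" if "\<beta> \<in> coordinate_one_roots \<Phi> \<Delta> \<alpha>" for \<beta>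
    using projected_root_in_scaled_polytope that by (simp add: coordinate_one_roots_eq)
  have \<alpha>1: "\<alpha> \<in> coordinate_one_roots \<Phi> \<Delta> \<alpha>"
    using \<alpha> simple_root by (simp add: coordinate_one_roots_eq inner_cw)
  show "is_minimum {r. 0 \<le> r \<and> proj \<alpha> \<in> (*\<^sub>R) r ` root_polytope (parabolic_subsystem \<Phi> \<Delta> \<alpha>)} bound"
    unfolding is_minimum_def parabolic_subsystem_eq
    using bound_nonneg mem[OF \<alpha>1] bound_le_of_mem_scaled_polytope by blast
  show "is_minimum {r. 0 \<le> r \<and> proj ` coordinate_one_roots \<Phi> \<Delta> \<alpha>
      \<subseteq> (*\<^sub>R) r ` root_polytope (parabolic_subsystem \<Phi> \<Delta> \<alpha>)} bound"
    unfolding is_minimum_def parabolic_subsystem_eq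
    using bound_nonneg mem \<alpha>1 bound_le_of_mem_scaled_polytope by blast
qed

end
end

theorem proposition7p4:
  fixes \<Phi> \<Delta> :: "'a::euclidean_space set" and \<alpha> :: 'a
  assumes "root_system \<Phi>"
    and "irreducible_roots \<Phi>"
    and "simple_system \<Phi> \<Delta>"
    and "\<alpha> \<in> \<Delta>"
  shows "is_minimum
           {r. 0 \<le> r \<and> parabolic_projection \<Delta> \<alpha> ` coordinate_one_roots \<Phi> \<Delta> \<alpha>
                  \<subseteq> (*\<^sub>R) r ` root_polytope (parabolic_subsystem \<Phi> \<Delta> \<alpha>)}
           (\<Sum>\<epsilon>\<in>neighbours \<Delta> \<alpha>. - (\<alpha> \<bullet> coroot \<epsilon>) * component_constant \<Phi> \<Delta> \<alpha> \<epsilon>) \<and>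
         is_minimum
           {r. 0 \<le> r \<and> parabolic_projection \<Delta> \<alpha> \<alpha>
                  \<in> (*\<^sub>R) r ` root_polytope (parabolic_subsystem \<Phi> \<Delta> \<alpha>)}
           (\<Sum>\<epsilon>\<in>neighbours \<Delta> \<alpha>. - (\<alpha> \<bullet> coroot \<epsilon>) * component_constant \<Phi> \<Delta> \<alpha> \<epsilon>)"
proof -
  interpret simple_roots \<Phi> \<Delta> using assms(1,3) by unfold_locales
  show ?thesis using minimal_scalings[OF assms(4)] by (rule conjI)
qed

end
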